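(* Let $\{f;\,f_k,k\in\mathbb{N}\}\subset\Gamma(X)$, consider the countable convex problem $(\mathrm{P}_{\mathbb{N}})$: $\inf f(x)$ s.t. $f_k(x)\le0$, $k\in\mathbb{N}$, and assume that $\inf(\mathrm{P}_{\mathbb{N}})\ne+\infty$. The following statements are equivalent: (i) $\inf(\mathrm{P}_{\mathbb{N}})=\max(\mathrm{D}_m)$ for all $m\in\mathbb{N}$ sufficiently large. (ii) $\mathcal{A}$ is $w^*$-closed regarding $\{0_{X^*}\}\times\mathbb{R}$.
   Context: $X$ is a locally convex Hausdorff (real) topological vector space; its topological dual $X^*$ (null element $0_{X^*}$) carries the weak*-topology and $X^*\times\mathbb{R}$ the product topology. $\Gamma(X)$ is the class of lower semicontinuous proper convex functions $X\to\mathbb{R}\cup\{+\infty\}$. The convention $0\times(+\infty)=0$ is used. For $h:X\to\overline{\mathbb{R}}$, $h^*(x^* )=\sup_{x\in X}\{\langle x^*,x\rangle-h(x)\}$ and $\operatorname{epi}h^*=\{(x^*,r)\in X^*\times\mathbb{R}:h^*(x^* )\le r\}$. For $m\in\mathbb{N}$, $(\mathrm{D}_m)$: $\sup_{\mu\in\mathbb{R}_+^m}\inf_{x\in X}\left\{f(x)+\sum_{k=1}^m\mu_kf_k(x)\right\}$; writing $\max(\mathrm{D}_m)$ means that the supremum over $\mu$ (in $\overline{\mathbb{R}}$) is attained. $\mathcal{A}:=\bigcup_{\lambda\in\mathbb{R}_+^{(\mathbb{N})}}\operatorname{epi}\left(f+\sum_{k\in\mathbb{N}}\lambda_kf_k\right)^*$,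 where $\mathbb{R}_+^{(\mathbb{N})}$ is the set of finitely supported sequences of nonnegative reals and the sum is over the support of $\lambda$ (equal to $0$ if the support is empty). A set $\mathbb{A}\subset X^*\times\mathbb{R}$ is $w^*$-closed regarding $\mathbb{B}\subset X^*\times\mathbb{R}$ if $\overline{\mathbb{A}}\cap\mathbb{B}=\mathbb{A}\cap\mathbb{B}$. *)

theory Defs
  imports "HOL-Analysis.Analysis"
begin

text \<open>
  Real locally convex Hausdorff topological vector spaces. The constant \<^const>\<open>convex\<close> cannot be
  used inside a class specification, so its definition is written out in \<open>convex_nhds_zero\<close>.
\<close>

class locally_convex_space = topological_ab_group_add + real_vector + t2_space +
  assumes tendsto_scaleR_Pair: "LIM x (nhds a \<times>\<^sub>F nhds b). fst x *\<^sub>R snd x :> nhds (a *\<^sub>R b)"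
    and convex_nhds_zero: "open U \<Longrightarrow> 0 \<in> U \<Longrightarrow> \<exists>V. open V \<and> 0 \<in> V \<and> V \<subseteq> U \<and>
          (\<forall>x\<in>V. \<forall>y\<in>V. \<forall>u\<ge>0. \<forall>v\<ge>0. u + v = 1 \<longrightarrow> u *\<^sub>R x + v *\<^sub>R y \<in> V)"

definition dual_space :: "('a::locally_convex_space \<Rightarrow> real) set" where
  "dual_space = {xs. linear xs \<and> continuous_on UNIV xs}"

text \<open>The weak* topology is the topology of pointwise convergence on the dual.\<close>

definition weak_star :: "('a::locally_convex_space \<Rightarrow> real) topology" where
  "weak_star = subtopology (powertop_real UNIV) dual_space"

definition dual_times_real :: "(('a::locally_convex_space \<Rightarrow> real) \<times> real) topology" where
  "dual_times_real = prod_topology weak_star euclideanreal"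

definition wstar_closed_regarding ::
    "(('a::locally_convex_space \<Rightarrow> real) \<times> real) set \<Rightarrow> (('a \<Rightarrow> real) \<times> real) set \<Rightarrow> bool" where
  "wstar_closed_regarding A B \<longleftrightarrow> (dual_times_real closure_of A) \<inter> B = A \<inter> B"

definition proper_fun :: "('a \<Rightarrow> ereal) \<Rightarrow> bool" where
  "proper_fun h \<longleftrightarrow> (\<forall>x. h x \<noteq> -\<infinity>) \<and> (\<exists>x. h x \<noteq> \<infinity>)"

definition lsc_fun :: "('a::topological_space \<Rightarrow> ereal) \<Rightarrow> bool" where
  "lsc_fun h \<longleftrightarrow> (\<forall>x c. c < h x \<longrightarrow> (\<forall>\<^sub>F y in nhds x. c < h y))"

definition convex_fun :: "('a::real_vector \<Rightarrow> ereal) \<Rightarrow> bool" where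
  "convex_fun h \<longleftrightarrow> convex {(x, r::real). h x \<le> ereal r}"

definition lsc_proper_convex :: "('a::locally_convex_space \<Rightarrow> ereal) set" where
  "lsc_proper_convex = {h. proper_fun h \<and> lsc_fun h \<and> convex_fun h}"

definition conjugate :: "('a::locally_convex_space \<Rightarrow> ereal) \<Rightarrow> ('a \<Rightarrow> real) \<Rightarrow> ereal" where
  "conjugate h xs = (SUP x. ereal (xs x) - h x)"

definition epi_conjugate ::
    "('a::locally_convex_space \<Rightarrow> ereal) \<Rightarrow> (('a \<Rightarrow> real) \<times> real) set" where
  "epi_conjugate h = {(xs, r). xs \<in> dual_space \<and> conjugate h xs \<le> ereal r}"

text \<open>
  The constraints are indexed by the positive integers; the value \<open>fs 0\<close> is never used.
  The convention that zero times infinity is zero is the one built into \<^typ>\<open>ereal\<close>.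
\<close>

definition lagrangian ::
    "('a \<Rightarrow> ereal) \<Rightarrow> (nat \<Rightarrow> 'a \<Rightarrow> ereal) \<Rightarrow> nat set \<Rightarrow> (nat \<Rightarrow> real) \<Rightarrow> 'a \<Rightarrow> ereal" where
  "lagrangian f fs K l x = f x + (\<Sum>k\<in>K. ereal (l k) * fs k x)"

definition inf_primal :: "('a \<Rightarrow> ereal) \<Rightarrow> (nat \<Rightarrow> 'a \<Rightarrow> ereal) \<Rightarrow> ereal" where
  "inf_primal f fs = Inf (f ` {x. \<forall>k\<ge>1. fs k x \<le> 0})"

definition multipliers :: "nat \<Rightarrow> (nat \<Rightarrow> real) set" where
  "multipliers m = {1..m} \<rightarrow>\<^sub>E {0..}"

definition dual_objective ::
    "('a \<Rightarrow> ereal) \<Rightarrow> (nat \<Rightarrow> 'a \<Rightarrow> ereal) \<Rightarrow> nat \<Rightarrow> (nat \<Rightarrow> real) \<Rightarrow> ereal" where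
  "dual_objective f fs m \<mu> = (INF x. lagrangian f fs {1..m} \<mu> x)"

definition sup_dual :: "('a \<Rightarrow> ereal) \<Rightarrow> (nat \<Rightarrow> 'a \<Rightarrow> ereal) \<Rightarrow> nat \<Rightarrow> ereal" where
  "sup_dual f fs m = (SUP \<mu>\<in>multipliers m. dual_objective f fs m \<mu>)"

definition dual_attained :: "('a \<Rightarrow> ereal) \<Rightarrow> (nat \<Rightarrow> 'a \<Rightarrow> ereal) \<Rightarrow> nat \<Rightarrow> bool" where
  "dual_attained f fs m \<longleftrightarrow> (\<exists>\<mu>\<in>multipliers m. dual_objective f fs m \<mu> = sup_dual f fs m)"

definition finite_support_multipliers :: "(nat \<Rightarrow> real) set" where
  "finite_support_multipliers =
     {l. (\<forall>k. 0 \<le> l k) \<and> finite {k. l k \<noteq> 0} \<and> l 0 = 0}"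

definition characteristic_set ::
    "('a::locally_convex_space \<Rightarrow> ereal) \<Rightarrow> (nat \<Rightarrow> 'a \<Rightarrow> ereal) \<Rightarrow> (('a \<Rightarrow> real) \<times> real) set" where
  "characteristic_set f fs =
     (\<Union>l\<in>finite_support_multipliers. epi_conjugate (lagrangian f fs {k. l k \<noteq> 0} l))"

end

theory Submission
  imports Defs "HOL-Library.Function_Algebras"
begin

text \<open>
  Write \<open>P\<close> for the value of the primal problem, \<open>A\<close> for the characteristic set, and \<open>L l\<close> for the
  Lagrangian of a finitely supported multiplier \<open>l \<ge> 0\<close>. Both sides of the equivalence are statements
  about which numbers \<open>r\<close> satisfy \<open>(0, r) \<in> A\<close>. By the definition of the conjugate, \<open>(0, r) \<in> A\<close> means
  that some \<open>L l\<close> is bounded below by \<open>- r\<close>. A multiplier whose support lies in \<open>{1..m}\<close> is the same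
  thing as a multiplier of the \<open>m\<close>-th dual problem, so \<open>(0, r) \<in> A\<close> holds iff the value \<open>- r\<close> is reached
  by a dual objective for some \<open>m\<close>, and then for all larger \<open>m\<close> as well. By weak duality, the
  duality assertion says that for large \<open>m\<close> some dual objective reaches \<open>P\<close>.

  The heart of the matter is \<open>zero_mem_closure_characteristic_set\<close>: the point \<open>(0, r)\<close> lies in the
  weak* closure of \<open>A\<close> iff \<open>- r \<le> P\<close>. Given this, the closedness condition says
  that every real lower bound of \<open>P\<close> is reached by a dual objective. If \<open>P\<close> is finite, this is the
  duality assertion, since \<open>P\<close> itself is the decisive lower bound; if \<open>P = - \<infinity>\<close>, there are no real
  lower bounds, and the duality assertion is weak duality.

  One inclusion of that description holds because each feasible \<open>x\<close> confines \<open>A\<close> to the closed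
  half-space of all \<open>(h, s)\<close> with \<open>h x - s \<le> f x\<close>. For the other one, suppose that \<open>- r \<le> P\<close> and that
  \<open>(0, r)\<close> is outside the closure. The set \<open>A\<close> is convex because \<open>L l\<close> is concave in \<open>l\<close>, so \<open>(0, r)\<close>
  can be strictly separated from \<open>A\<close>; weak* continuous functionals are evaluations at points, so the
  separation is given by some \<open>y\<close> in the original space and some \<open>M < - r\<close> with \<open>h y - s \<le> M\<close> on \<open>A\<close>.
  Each \<open>L l\<close> is a closed proper convex function, hence the supremum of its continuous affine minorants,
  and therefore \<open>L l y \<le> M\<close> for all \<open>l\<close>. Letting single multipliers tend to infinity shows that \<open>y\<close> is
  feasible, and \<open>l = 0\<close> gives \<open>f y \<le> M < - r \<le> P\<close>, a contradiction.

  The two separation arguments, in the space \<open>X \<times> \<real>\<close> for the Fenchel--Moreau theorem and in the space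
  of all real functions on \<open>X\<close>, times \<open>\<real>\<close>, for the weak* topology, are instances of one purely algebraic
  separation lemma, \<open>separate_convex_from_absorbing\<close>, which rests on the Hahn--Banach theorem.
\<close>

section \<open>The Hahn--Banach theorem\<close>

definition sublinear :: "('v::real_vector \<Rightarrow> real) \<Rightarrow> bool" where
  "sublinear p \<longleftrightarrow> (\<forall>x y. p (x + y) \<le> p x + p y) \<and> (\<forall>c\<ge>0. \<forall>x. p (c *\<^sub>R x) = c * p x)"

lemma sublinearI:
  assumes add: "\<And>x y. p (x + y) \<le> p x + p y"
    and scale: "\<And>c x. c > 0 \<Longrightarrow> p (c *\<^sub>R x) \<le> c * p x"
    and zero: "p 0 = 0"
  shows "sublinear p"
proof -
  have "p (c *\<^sub>R x) = c * p x" if "c \<ge> 0" for c x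
  proof (cases "c = 0")
    case False
    with that have c: "c > 0" by simp
    have "p (inverse c *\<^sub>R (c *\<^sub>R x)) \<le> inverse c * p (c *\<^sub>R x)"
      using c by (intro scale) simp
    then have "c * p x \<le> p (c *\<^sub>R x)"
      using c by (simp add: field_simps)
    with scale[OF c, of x] show ?thesis by simp
  qed (simp add: zero)
  with add show ?thesis by (auto simp: sublinear_def)
qed

lemma sublinear_add: "sublinear p \<Longrightarrow> p (x + y) \<le> p x + p y"
  by (simp add: sublinear_def)

lemma sublinear_scale: "sublinear p \<Longrightarrow> c \<ge> 0 \<Longrightarrow> p (c *\<^sub>R x) = c * p x"
  by (simp add: sublinear_def)

lemma sublinear_zero: "sublinear p \<Longrightarrow> p 0 = 0"
  using sublinear_scale[of p 0 0] by simp

lemma sublinear_minus: "sublinear p \<Longrightarrow> - p (- x) \<le> p x"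
  using sublinear_add[of p x "- x"] sublinear_zero[of p] by simp

text \<open>
  The functional \<open>q x = inf {p (x + t z) - t p z | t \<ge> 0}\<close> is the largest sublinear functional below
  \<open>p\<close> whose value at \<open>- z\<close> is at most \<open>- p z\<close>. Descending from \<open>p\<close> to \<open>q\<close> is thus a way of making \<open>p\<close>
  linear along \<open>z\<close>.
\<close>

lemma sublinear_descent:
  assumes p: "sublinear p"
  obtains q where "sublinear q" "q \<le> p" "q (- z) \<le> - p z"
proof -
  define F where "F x t = p (x + t *\<^sub>R z) - t * p z" for x t
  define q where "q x = (INF t\<in>{0..}. F x t)" for x
  have low: "- p (- x) \<le> F x t" if "t \<ge> 0" for x t
    using sublinear_add[OF p, of "x + t *\<^sub>R z" "- x"] sublinear_scale[OF p that, of z]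
    by (simp add: F_def)
  have bdd: "bdd_below (F x ` {0..})" for x
    using low by (intro bdd_belowI2[of _ "- p (- x)"]) auto
  have le: "q x \<le> F x t" if "t \<ge> 0" for x t
    unfolding q_def using that by (intro cINF_lower bdd) auto
  have ge: "b \<le> q x" if "\<And>t. t \<ge> 0 \<Longrightarrow> b \<le> F x t" for b x
    unfolding q_def using that by (intro cINF_greatest) auto
  have "sublinear q"
  proof (rule sublinearI)
    fix x y
    have step: "q (x + y) \<le> F x t + F y u" if "t \<ge> 0" "u \<ge> 0" for t u
    proof -
      have "q (x + y) \<le> F (x + y) (t + u)"
        using that by (intro le) simp
      also have "\<dots> \<le> F x t + F y u"
        using sublinear_add[OF p, of "x + t *\<^sub>R z" "y + u *\<^sub>R z"]
        by (simp add: F_def algebra_simps)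
      finally show ?thesis .
    qed
    have "q (x + y) - F y u \<le> q x" if "u \<ge> 0" for u
      using step[OF _ that] by (intro ge) (simp add: algebra_simps)
    then have "q (x + y) - q x \<le> q y"
      by (intro ge) (simp add: algebra_simps)
    then show "q (x + y) \<le> q x + q y" by simp
  next
    fix c :: real and x assume c: "c > 0"
    have "q (c *\<^sub>R x) / c \<le> q x"
    proof (rule ge)
      fix t :: real assume "t \<ge> 0"
      then have "q (c *\<^sub>R x) \<le> F (c *\<^sub>R x) (c * t)"
        using c by (intro le) simp
      also have "\<dots> = c * F x t"
        using sublinear_scale[OF p, of c "x + t *\<^sub>R z"] c by (simp add: F_def algebra_simps)
      finally show "q (c *\<^sub>R x) / c \<le> F x t"
        using c by (simp add: field_simps)
    qed
    then show "q (c *\<^sub>R x) \<le> c * q x"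
      using c by (simp add: field_simps)
  next
    have "F 0 t = 0" if "t \<ge> 0" for t
      using sublinear_scale[OF p that, of z] by (simp add: F_def)
    then show "q 0 = 0"
      by (simp add: q_def)
  qed
  moreover have "q \<le> p"
    using le[of 0] by (auto simp: le_fun_def F_def)
  moreover have "q (- z) \<le> - p z"
    using le[of 1 "- z"] sublinear_zero[OF p] by (simp add: F_def)
  ultimately show thesis by (rule that)
qed

text \<open>
  Minimality makes the descent along each \<open>z\<close> trivial, so \<open>q\<close> is odd; applying subadditivity to
  \<open>- x\<close> and \<open>- y\<close> then reverses the inequality \<open>q (x + y) \<le> q x + q y\<close>.
\<close>

lemma minimal_sublinear_is_linear:
  assumes q: "sublinear q" and min: "\<And>r. sublinear r \<Longrightarrow> r \<le> q \<Longrightarrow> r = q"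
  shows "linear q"
proof -
  have odd: "q (- z) = - q z" for z
  proof -
    obtain r where "sublinear r" "r \<le> q" "r (- z) \<le> - q z"
      using sublinear_descent[OF q] by blast
    then have "q (- z) \<le> - q z" using min by blast
    then show ?thesis using sublinear_minus[OF q, of z] by linarith
  qed
  show ?thesis
  proof (rule linearI)
    fix x y
    show "q (x + y) = q x + q y"
      using sublinear_add[OF q, of x y] sublinear_add[OF q, of "- x" "- y"] odd
      by (smt (verit) minus_add_distrib)
  next
    fix c :: real and x
    show "q (c *\<^sub>R x) = c *\<^sub>R q x"
    proof (cases "c \<ge> 0")
      case False
      then have "q ((- c) *\<^sub>R x) = - c * q x"
        by (intro sublinear_scale q) simp
      then show ?thesis using odd[of "c *\<^sub>R x"] by simp
    qed (simp add: sublinear_scale[OF q])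
  qed
qed

text \<open>
  The lower bounds that Zorn's lemma asks for: in a chain, two members have a common smaller member,
  which is why the pointwise infimum stays subadditive.
\<close>

lemma sublinear_INF_chain:
  assumes C: "C \<noteq> {}" "\<And>q. q \<in> C \<Longrightarrow> sublinear q" "\<And>q. q \<in> C \<Longrightarrow> q \<le> p"
    and chain: "\<And>q r. q \<in> C \<Longrightarrow> r \<in> C \<Longrightarrow> q \<le> r \<or> r \<le> q"
  obtains m where "sublinear m" "\<And>q. q \<in> C \<Longrightarrow> m \<le> q"
proof -
  define m where "m x = (INF q\<in>C. q x)" for x
  have low: "- p (- x) \<le> q x" if "q \<in> C" for q x
    using sublinear_minus[OF C(2)[OF that], of x] C(3)[OF that] by (smt (verit) le_funD)
  have bdd: "bdd_below ((\<lambda>q. q x) ` C)" for x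
    using low by (intro bdd_belowI2[of _ "- p (- x)"]) auto
  have le: "m x \<le> q x" if "q \<in> C" for x q
    unfolding m_def using that by (intro cINF_lower bdd) auto
  have ge: "b \<le> m x" if "\<And>q. q \<in> C \<Longrightarrow> b \<le> q x" for b x
    unfolding m_def using that C(1) by (intro cINF_greatest) auto
  have "sublinear m"
  proof (rule sublinearI)
    fix x y
    have step: "m (x + y) \<le> q x + r y" if qr: "q \<in> C" "r \<in> C" for q r
    proof -
      obtain s where "s \<in> C" "s \<le> q" "s \<le> r"
        using chain[OF qr] qr by blast
      then show ?thesis
        using le[of s "x + y"] sublinear_add[OF C(2), of s x y] by (smt (verit) le_funD)
    qed
    have "m (x + y) - r y \<le> m x" if "r \<in> C" for r
      using step[OF _ that] by (intro ge) (simp add: algebra_simps)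
    then have "m (x + y) - m x \<le> m y"
      by (intro ge) (simp add: algebra_simps)
    then show "m (x + y) \<le> m x + m y" by simp
  next
    fix c :: real and x assume c: "c > 0"
    have "m (c *\<^sub>R x) / c \<le> m x"
    proof (rule ge)
      fix q assume q: "q \<in> C"
      then show "m (c *\<^sub>R x) / c \<le> q x"
        using le[OF q, of "c *\<^sub>R x"] sublinear_scale[OF C(2)[OF q], of c x] c
        by (simp add: field_simps)
    qed
    then show "m (c *\<^sub>R x) \<le> c * m x"
      using c by (simp add: field_simps)
  next
    show "m 0 = 0"
      using C(1) by (simp add: m_def sublinear_zero[OF C(2)] cong: INF_cong_simp)
  qed
  then show thesis using le by (intro that) (auto simp: le_fun_def)
qed

lemma ex_linear_below_sublinear:
  assumes p: "sublinear p"
  obtains \<phi> where "linear \<phi>" "\<phi> \<le> p"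
proof -
  define A where "A = {q. sublinear q \<and> q \<le> p}"
  define R where "R = relation_of (\<lambda>q r. r \<le> q) A"
  have "\<exists>m\<in>A. \<forall>q\<in>A. q \<le> m \<longrightarrow> q = m"
  proof (rule predicate_Zorn)
    show "partial_order_on A (relation_of (\<lambda>q r. r \<le> q) A)"
      by (rule partial_order_on_relation_ofI) auto
  next
    fix C assume C: "C \<in> Chains (relation_of (\<lambda>q r. r \<le> q) A)"
    then have CA: "C \<subseteq> A"
      by (auto simp: Chains_def relation_of_def)
    show "\<exists>u\<in>A. \<forall>q\<in>C. u \<le> q"
    proof (cases "C = {}")
      case True
      with p show ?thesis by (auto simp: A_def)
    next
      case False
      then obtain q0 where q0: "q0 \<in> C" by blast
      obtain m where m: "sublinear m" "\<And>q. q \<in> C \<Longrightarrow> m \<le> q"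
      proof (rule sublinear_INF_chain[of C p])
        show "q \<le> r \<or> r \<le> q" if "q \<in> C" "r \<in> C" for q r
          using C that by (auto simp: Chains_def relation_of_def)
      qed (use False CA A_def in auto)
      have "m \<le> p"
        using m(2)[OF q0] q0 CA by (auto simp: A_def)
      with m show ?thesis by (auto simp: A_def)
    qed
  qed
  then obtain q where q: "sublinear q" "q \<le> p" "\<And>r. sublinear r \<Longrightarrow> r \<le> p \<Longrightarrow> r \<le> q \<Longrightarrow> r = q"
    by (auto simp: A_def)
  have "linear q"
    by (rule minimal_sublinear_is_linear[OF q(1)]) (use q in \<open>blast intro: order_trans\<close>)
  from this q(2) show thesis by (rule that)
qed

lemma hahn_banach:
  assumes p: "sublinear p"
  obtains \<phi> where "linear \<phi>" "\<phi> \<le> p" "\<phi> z = p z"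
proof -
  obtain q where q: "sublinear q" "q \<le> p" "q (- z) \<le> - p z"
    using sublinear_descent[OF p] by blast
  obtain \<phi> where \<phi>: "linear \<phi>" "\<phi> \<le> q"
    using ex_linear_below_sublinear[OF q(1)] by blast
  have "\<phi> z \<ge> p z"
    using \<phi> q(3) linear_neg[OF \<phi>(1), of z] by (smt (verit) le_funD)
  with \<phi> q(2) show thesis
    by (intro that[of \<phi>]) (auto simp: le_fun_def intro: order_trans antisym)
qed

section \<open>Separation of convex sets\<close>

definition absorbing :: "'v::real_vector set \<Rightarrow> bool" where
  "absorbing U \<longleftrightarrow> (\<forall>v. \<exists>e>0. e *\<^sub>R v \<in> U)"

lemma absorbing_zero: "absorbing U \<Longrightarrow> 0 \<in> U"
  by (force simp: absorbing_def dest: spec[of _ 0])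

lemma absorbing_Times:
  assumes U: "absorbing U" "convex U" and V: "absorbing V" "convex V"
  shows "absorbing (U \<times> V)"
proof -
  have shrink: "d *\<^sub>R x \<in> W"
    if "convex W" "absorbing W" "e *\<^sub>R x \<in> W" "0 < d" "d \<le> e" for d e :: real and x and W :: "'c::real_vector set"
  proof -
    have "(d / e) *\<^sub>R (e *\<^sub>R x) + (1 - d / e) *\<^sub>R 0 \<in> W"
      using that absorbing_zero[OF that(2)] by (intro convexD[OF that(1)]) auto
    then show ?thesis using that by simp
  qed
  show ?thesis
    unfolding absorbing_def
  proof
    fix p :: "'a \<times> 'b"
    obtain e d where "0 < e" "e *\<^sub>R fst p \<in> U" "0 < d" "d *\<^sub>R snd p \<in> V"
      using U V unfolding absorbing_def by metis
    then have "min e d *\<^sub>R p \<in> U \<times> V"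
      using shrink[OF U(2,1), of e "fst p" "min e d"] shrink[OF V(2,1), of d "snd p" "min e d"]
      by (simp add: mem_Times_iff)
    then show "\<exists>e>0. e *\<^sub>R p \<in> U \<times> V"
      using \<open>0 < e\<close> \<open>0 < d\<close> by (intro exI[of _ "min e d"]) simp
  qed
qed

lemma convex_abs_less: "convex {t::real. \<bar>t\<bar> < e}"
proof -
  have "{t. \<bar>t\<bar> < e} = {- e<..<e}" by auto
  then show ?thesis by (simp add: convex_real_interval)
qed

lemma absorbing_abs_less:
  assumes "0 < e"
  shows "absorbing {t::real. \<bar>t\<bar> < e}"
  unfolding absorbing_def
proof
  fix v :: real
  have "e / (\<bar>v\<bar> + 1) * \<bar>v\<bar> < e"
    using assms by (simp add: field_simps add_nonneg_pos)
  then show "\<exists>d>0. d *\<^sub>R v \<in> {t. \<bar>t\<bar> < e}"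
    using assms by (intro exI[of _ "e / (\<bar>v\<bar> + 1)"]) (simp add: abs_mult add_nonneg_pos)
qed

text \<open>
  The Minkowski functional of \<open>D\<close>.
\<close>

definition gauge_of :: "'v::real_vector set \<Rightarrow> 'v \<Rightarrow> real" where
  "gauge_of D x = Inf {t. 0 < t \<and> inverse t *\<^sub>R x \<in> D}"

lemma gauge_of_le: "0 < t \<Longrightarrow> inverse t *\<^sub>R x \<in> D \<Longrightarrow> gauge_of D x \<le> t"
  unfolding gauge_of_def by (rule cInf_lower) (auto intro!: bdd_belowI[of _ 0])

lemma le_gauge_of:
  assumes "absorbing D" "\<And>t. 0 < t \<Longrightarrow> inverse t *\<^sub>R x \<in> D \<Longrightarrow> b \<le> t"
  shows "b \<le> gauge_of D x"
proof -
  obtain e where "e > 0" "e *\<^sub>R x \<in> D"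
    using assms(1) by (auto simp: absorbing_def)
  then have "inverse e \<in> {t. 0 < t \<and> inverse t *\<^sub>R x \<in> D}"
    by simp
  then show ?thesis
    unfolding gauge_of_def using assms(2) by (intro cInf_greatest) blast+
qed

lemma sublinear_gauge_of:
  assumes D: "absorbing D" "convex D"
  shows "sublinear (gauge_of D)"
proof (rule sublinearI)
  fix x y :: 'a
  have step: "gauge_of D (x + y) \<le> t + u"
    if t: "0 < t" "inverse t *\<^sub>R x \<in> D" and u: "0 < u" "inverse u *\<^sub>R y \<in> D" for t u
  proof (rule gauge_of_le)
    have "(t / (t + u)) *\<^sub>R (inverse t *\<^sub>R x) + (u / (t + u)) *\<^sub>R (inverse u *\<^sub>R y) \<in> D"
      using t u by (intro convexD[OF D(2)]) (auto simp: add_divide_distrib[symmetric])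
    then show "inverse (t + u) *\<^sub>R (x + y) \<in> D"
      using t(1) u(1) by (simp add: scaleR_add_right inverse_eq_divide)
  qed (use t u in simp)
  have "gauge_of D (x + y) - u \<le> gauge_of D x" if "0 < u" "inverse u *\<^sub>R y \<in> D" for u
    using step[OF _ _ that] by (intro le_gauge_of D) (simp add: algebra_simps)
  then have "gauge_of D (x + y) - gauge_of D x \<le> gauge_of D y"
    by (intro le_gauge_of D) (simp add: algebra_simps)
  then show "gauge_of D (x + y) \<le> gauge_of D x + gauge_of D y" by simp
next
  fix c :: real and x :: 'a assume c: "c > 0"
  have "gauge_of D (c *\<^sub>R x) / c \<le> gauge_of D x"
  proof (rule le_gauge_of[OF D(1)])
    fix t :: real assume "0 < t" "inverse t *\<^sub>R x \<in> D"
    then have "gauge_of D (c *\<^sub>R x) \<le> c * t"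
      using c by (intro gauge_of_le) (auto simp: inverse_eq_divide)
    then show "gauge_of D (c *\<^sub>R x) / c \<le> t"
      using c by (simp add: field_simps)
  qed
  then show "gauge_of D (c *\<^sub>R x) \<le> c * gauge_of D x"
    using c by (simp add: field_simps)
next
  have "gauge_of D 0 \<le> 0"
    by (rule field_le_epsilon) (use gauge_of_le[of _ 0 D] absorbing_zero[OF D(1)] in auto)
  moreover have "0 \<le> gauge_of D 0"
    by (rule le_gauge_of) (use D in auto)
  ultimately show "gauge_of D 0 = 0" by simp
qed

text \<open>
  The set \<open>D = c0 + U - C\<close> is convex, absorbing, and misses \<open>c0\<close>, so a linear functional that is
  dominated by the gauge of \<open>D\<close> and agrees with it at \<open>c0\<close> separates. The absorbing set stands for a
  neighbourhood of \<open>0\<close>: the bound \<open>K\<close> on \<open>U\<close> is what makes \<open>\<phi>\<close> continuous once \<open>U\<close> is chosen from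
  the topology at hand, and \<open>\<delta>\<close> is a positive value that \<open>\<phi>\<close> takes on \<open>U\<close>.
\<close>

lemma separate_convex_from_absorbing:
  fixes C U :: "'v::real_vector set"
  assumes C: "convex C" "C \<noteq> {}" and U: "convex U" "absorbing U" and disj: "C \<inter> U = {}"
  obtains \<phi> :: "'v \<Rightarrow> real" and \<delta> K where "linear \<phi>" "0 < \<delta>" "\<And>c. c \<in> C \<Longrightarrow> \<delta> \<le> \<phi> c" "\<And>u. u \<in> U \<Longrightarrow> \<phi> u \<le> K"
proof -
  obtain c0 where c0: "c0 \<in> C" using C by blast
  define D where "D = (+) c0 ` (\<Union>u\<in>U. \<Union>c\<in>C. {u - c})"
  have DI: "c0 + (u - c) \<in> D" if "u \<in> U" "c \<in> C" for u c
    using that by (auto simp: D_def)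
  have D: "convex D"
    unfolding D_def by (intro convex_translation convex_differences U C)
  have UD: "U \<subseteq> D"
    using DI[OF _ c0] by fastforce
  with U(2) have absD: "absorbing D"
    unfolding absorbing_def by blast
  have c0D: "c0 \<notin> D"
    using disj by (auto simp: D_def)
  have "1 \<le> gauge_of D c0"
  proof (rule le_gauge_of[OF absD], rule ccontr)
    fix t :: real assume t: "0 < t" "inverse t *\<^sub>R c0 \<in> D" and "\<not> 1 \<le> t"
    then have "t *\<^sub>R (inverse t *\<^sub>R c0) + (1 - t) *\<^sub>R 0 \<in> D"
      using absorbing_zero[OF absD] by (intro convexD[OF D]) auto
    with t c0D show False by simp
  qed
  moreover obtain \<phi> where \<phi>: "linear \<phi>" "\<phi> \<le> gauge_of D" "\<phi> c0 = gauge_of D c0"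
    using hahn_banach[OF sublinear_gauge_of[OF absD D]] by blast
  ultimately have c0_ge: "1 \<le> \<phi> c0" by simp
  have le: "\<phi> u \<le> \<phi> c" if "u \<in> U" "c \<in> C" for u c
  proof -
    have "\<phi> (c0 + (u - c)) \<le> 1"
      using \<phi>(2) gauge_of_le[of 1 "c0 + (u - c)" D] DI[OF that] by (auto simp: le_fun_def intro: order_trans)
    then show ?thesis
      using c0_ge by (simp add: linear_add[OF \<phi>(1)] linear_diff[OF \<phi>(1)])
  qed
  obtain e where e: "e > 0" "e *\<^sub>R c0 \<in> U"
    using U(2) by (auto simp: absorbing_def)
  show thesis
  proof (rule that[OF \<phi>(1)])
    show "0 < \<phi> (e *\<^sub>R c0)"
      using e c0_ge by (simp add: linear_scale[OF \<phi>(1)])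
    show "\<phi> (e *\<^sub>R c0) \<le> \<phi> c" if "c \<in> C" for c
      using le[OF e(2) that] .
    show "\<phi> u \<le> \<phi> c0" if "u \<in> U" for u
      using le[OF that c0] .
  qed
qed


section \<open>Closed convex functions are suprema of continuous affine functions\<close>

lemma dual_space_diff:
  assumes "h \<in> dual_space" "k \<in> dual_space"
  shows "(\<lambda>x. h x - k x) \<in> dual_space"
  using assms by (auto simp: dual_space_def intro: linear_compose_sub continuous_on_diff)

lemma dual_space_scale:
  assumes "h \<in> dual_space"
  shows "(\<lambda>x. c * h x) \<in> dual_space"
  using assms by (auto simp: dual_space_def intro: linear_compose_scale_right[of h c, simplified]
      continuous_on_mult_left)

lemma tendsto_scaleR_lcs:
  fixes F :: "'b filter" and v :: "'a::locally_convex_space"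
  assumes "(g \<longlongrightarrow> c) F" "(w \<longlongrightarrow> v) F"
  shows "((\<lambda>x. g x *\<^sub>R w x) \<longlongrightarrow> c *\<^sub>R v) F"
  using filterlim_compose[OF tendsto_scaleR_Pair filterlim_Pair[OF assms]] by simp

lemma absorbing_of_open:
  fixes U :: "'a::locally_convex_space set"
  assumes "open U" "0 \<in> U"
  shows "absorbing U"
  unfolding absorbing_def
proof
  fix v :: 'a
  have "((\<lambda>e::real. e *\<^sub>R v) \<longlongrightarrow> 0 *\<^sub>R v) (at_right 0)"
    by (intro tendsto_scaleR_lcs tendsto_const) (auto intro: tendsto_ident_at)
  then have "\<forall>\<^sub>F e in at_right (0::real). e *\<^sub>R v \<in> U"
    using assms by (auto simp: tendsto_def)
  moreover have "\<forall>\<^sub>F e in at_right (0::real). 0 < e"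
    by (simp add: eventually_at_right_less)
  ultimately have "\<forall>\<^sub>F e in at_right (0::real). 0 < e \<and> e *\<^sub>R v \<in> U"
    by eventually_elim simp
  then show "\<exists>e>0. e *\<^sub>R v \<in> U"
    using eventually_happens[of _ "at_right (0::real)"] by auto
qed

text \<open>
  A bound \<open>K\<close> on \<open>U\<close> scales to the bound \<open>e\<close> on the intersection of \<open>U\<close> and \<open>- U\<close>, each shrunk by the
  factor \<open>e / (K + 1)\<close>.
\<close>

lemma dual_space_if_bounded_near_zero:
  fixes \<psi> :: "'a::locally_convex_space \<Rightarrow> real"
  assumes lin: "linear \<psi>" and U: "open U" "0 \<in> U" and bound: "\<And>u. u \<in> U \<Longrightarrow> \<psi> u \<le> K"
  shows "\<psi> \<in> dual_space"
proof -
  have K: "K \<ge> 0"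
    using bound[OF U(2)] linear_0[OF lin] by simp
  have at_zero: "(\<psi> \<longlongrightarrow> 0) (nhds 0)"
  proof (rule tendstoI)
    fix e :: real assume e: "e > 0"
    define c where "c = (K + 1) / e"
    have c: "c > 0" using K e by (simp add: c_def)
    have "((\<lambda>y::'a. d *\<^sub>R y) \<longlongrightarrow> d *\<^sub>R 0) (nhds 0)" for d :: real
      by (intro tendsto_scaleR_lcs tendsto_const filterlim_ident)
    then have "\<forall>\<^sub>F y in nhds 0. d *\<^sub>R y \<in> U" for d :: real
      using U by (auto simp: tendsto_def)
    then have "\<forall>\<^sub>F y in nhds 0. c *\<^sub>R y \<in> U \<and> (- c) *\<^sub>R y \<in> U"
      by (intro eventually_conj)
    then show "\<forall>\<^sub>F y in nhds 0. dist (\<psi> y) 0 < e"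
    proof eventually_elim
      case (elim y)
      then have "c * \<psi> y \<le> K" "- (c * \<psi> y) \<le> K"
        using bound[of "c *\<^sub>R y"] bound[of "(- c) *\<^sub>R y"]
        by (auto simp: linear_scale[OF lin] linear_neg[OF lin])
      then have "c * \<bar>\<psi> y\<bar> < K + 1"
        by (auto simp: abs_if)
      also have "K + 1 = c * e"
        using e by (simp add: c_def)
      finally show ?case
        using c by simp
    qed
  qed
  have "(\<psi> \<longlongrightarrow> \<psi> x) (nhds x)" for x
  proof -
    have "((\<lambda>y. y - x) \<longlongrightarrow> x - x) (nhds x)"
      by (intro tendsto_diff tendsto_const filterlim_ident)
    then have "((\<lambda>y. \<psi> (y - x)) \<longlongrightarrow> 0) (nhds x)"
      using filterlim_compose[OF at_zero] by simp
    from tendsto_add[OF this tendsto_const[of "\<psi> x"]] show ?thesis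
      by (simp add: linear_diff[OF lin])
  qed
  then have "continuous_on UNIV \<psi>"
    by (simp add: continuous_on_def tendsto_nhds_iff)
  with lin show ?thesis by (simp add: dual_space_def)
qed

lemma mem_epi_conjugate:
  "(h, s) \<in> epi_conjugate g \<longleftrightarrow> h \<in> dual_space \<and> (\<forall>x. ereal (h x - s) \<le> g x)"
proof -
  have "ereal (h x) - g x \<le> ereal s \<longleftrightarrow> ereal (h x - s) \<le> g x" for x
    by (cases "g x") (auto simp: algebra_simps)
  then show ?thesis
    by (simp add: epi_conjugate_def conjugate_def SUP_le_iff)
qed

lemma not_MInf: "g \<in> lsc_proper_convex \<Longrightarrow> g x \<noteq> - \<infinity>"
  by (simp add: lsc_proper_convex_def proper_fun_def)

lemma ex_finite_value:
  assumes "g \<in> lsc_proper_convex"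
  obtains x a where "g x = ereal a"
proof -
  obtain x where "g x \<noteq> \<infinity>" "g x \<noteq> - \<infinity>"
    using assms by (auto simp: lsc_proper_convex_def proper_fun_def)
  then show thesis using that[of x] by (cases "g x") auto
qed

text \<open>
  Lower semicontinuity provides a neighbourhood of \<open>(x, c)\<close> that misses the epigraph, and the epigraph
  is separated from it. Since the epigraph is unbounded upwards, \<open>\<alpha> \<ge> 0\<close>. The hyperplane is vertical if
  \<open>\<alpha> = 0\<close>, which can happen when \<open>g x = \<infinity>\<close>.
\<close>

lemma separate_point_from_epigraph:
  assumes g: "g \<in> lsc_proper_convex" and c: "ereal c < g x"
  obtains \<psi> \<alpha> \<delta> where "\<psi> \<in> dual_space" "0 \<le> \<alpha>" "0 < \<delta>"
    "\<And>y s. g y \<le> ereal s \<Longrightarrow> \<delta> \<le> \<psi> y - \<psi> x + \<alpha> * (s - c)"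
proof -
  have lsc: "lsc_fun g" and cvx: "convex {(y, s::real). g y \<le> ereal s}"
    using g by (auto simp: lsc_proper_convex_def convex_fun_def)
  obtain y0 s0 where y0: "g y0 \<le> ereal s0"
  proof -
    obtain y a where "g y = ereal a"
      by (rule ex_finite_value[OF g])
    then show thesis using that[of y a] by simp
  qed
  \<comment> \<open>The gap between \<open>c\<close> and \<open>c'\<close> is the vertical extent of the neighbourhood of \<open>(x, c)\<close>.\<close>
  obtain c' where c': "c < c'" "ereal c' < g x"
    using ereal_dense2[OF c] by auto
  obtain V where V: "open V" "x \<in> V" "\<And>y. y \<in> V \<Longrightarrow> ereal c' < g y"
    using lsc c'(2) unfolding lsc_fun_def eventually_nhds by meson
  have "((\<lambda>u. x + u) \<longlongrightarrow> x + 0) (nhds 0)"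
    by (intro tendsto_add tendsto_const filterlim_ident)
  then have "\<forall>\<^sub>F u in nhds 0. x + u \<in> V"
    using V by (auto simp: tendsto_def)
  then obtain U1 where U1: "open U1" "0 \<in> U1" "\<And>u. u \<in> U1 \<Longrightarrow> x + u \<in> V"
    by (auto simp: eventually_nhds)
  obtain U where U: "open U" "0 \<in> U" "U \<subseteq> U1" "convex U"
    using convex_nhds_zero[OF U1(1,2)] by (auto simp: convex_def)
  define W where "W = U \<times> {t. \<bar>t\<bar> < c' - c}"
  define C where "C = (+) (- (x, c)) ` {(y, s). g y \<le> ereal s}"
  have CI: "(y - x, s - c) \<in> C" if "g y \<le> ereal s" for y s
    unfolding C_def using that by (intro image_eqI[of _ _ "(y, s)"]) auto
  have "convex C"
    unfolding C_def by (intro convex_translation cvx)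
  moreover have "C \<noteq> {}"
    using CI[OF y0] by blast
  moreover have "convex W"
    unfolding W_def by (intro convex_Times U convex_abs_less)
  moreover have "absorbing W"
    unfolding W_def using c'(1)
    by (intro absorbing_Times absorbing_of_open absorbing_abs_less U convex_abs_less) auto
  moreover have "C \<inter> W = {}"
  proof -
    have False if "g y \<le> ereal s" "y - x \<in> U" "\<bar>s - c\<bar> < c' - c" for y s
    proof -
      have "ereal c' < g y"
        using V(3) U1(3)[of "y - x"] U(3) that(2) by auto
      also note that(1)
      finally show False using that(3) by simp
    qed
    then show ?thesis by (auto simp: C_def W_def)
  qed
  ultimately obtain \<phi> :: "_ \<Rightarrow> real" and \<delta> K where \<phi>: "linear \<phi>" "0 < \<delta>" "\<And>p. p \<in> C \<Longrightarrow> \<delta> \<le> \<phi> p"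
    "\<And>p. p \<in> W \<Longrightarrow> \<phi> p \<le> K"
    using separate_convex_from_absorbing[of C W] by metis
  define \<psi> where "\<psi> y = \<phi> (y, 0)" for y
  define \<alpha> where "\<alpha> = \<phi> (0, 1)"
  have split: "\<phi> (y, s) = \<psi> y + \<alpha> * s" for y s
    using linear_add[OF \<phi>(1), of "(y, 0)" "(0, s)"] linear_scale[OF \<phi>(1), of s "(0, 1)"]
    by (simp add: \<psi>_def \<alpha>_def)
  have lin: "linear \<psi>"
  proof (rule linearI)
    show "\<psi> (y + z) = \<psi> y + \<psi> z" for y z
      using linear_add[OF \<phi>(1), of "(y, 0)" "(z, 0)"] by (simp add: \<psi>_def)
    show "\<psi> (r *\<^sub>R y) = r *\<^sub>R \<psi> y" for r y
      using linear_scale[OF \<phi>(1), of r "(y, 0)"] by (simp add: \<psi>_def)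
  qed
  have ineq: "\<delta> \<le> \<psi> y - \<psi> x + \<alpha> * (s - c)" if "g y \<le> ereal s" for y s
    using \<phi>(3)[OF CI[OF that]] by (simp add: split linear_diff[OF lin])
  have \<alpha>: "0 \<le> \<alpha>"
  proof (rule ccontr)
    assume neg: "\<not> 0 \<le> \<alpha>"
    define s where "s = max s0 (c + (\<psi> y0 - \<psi> x) / (- \<alpha>))"
    have "g y0 \<le> ereal s"
      using y0 by (rule order_trans) (simp add: s_def)
    then have "\<delta> \<le> \<psi> y0 - \<psi> x + \<alpha> * (s - c)" by (rule ineq)
    moreover have "\<alpha> * (s - c) \<le> \<alpha> * ((\<psi> y0 - \<psi> x) / (- \<alpha>))"
      using neg by (intro mult_left_mono_neg) (auto simp: s_def)
    moreover have "\<alpha> * ((\<psi> y0 - \<psi> x) / (- \<alpha>)) = - (\<psi> y0 - \<psi> x)"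
      using neg by simp
    ultimately show False using \<phi>(2) by linarith
  qed
  have "\<psi> u \<le> K" if "u \<in> U" for u
    using \<phi>(4)[of "(u, 0)"] that c'(1) by (simp add: \<psi>_def W_def)
  then have "\<psi> \<in> dual_space"
    using dual_space_if_bounded_near_zero[OF lin U(1,2)] by blast
  with \<alpha> \<phi>(2) ineq show thesis
    by (intro that)
qed

text \<open>
  Used to tilt a possibly vertical separating hyperplane by a small amount without losing strictness.
\<close>

lemma small_perturbation:
  fixes \<delta> b :: real
  assumes "0 < \<delta>"
  obtains \<eta> where "0 < \<eta>" "0 < \<delta> + \<eta> * b"
proof
  define \<eta> where "\<eta> = \<delta> / (\<bar>b\<bar> + 1)"
  show \<eta>: "0 < \<eta>"
    using assms by (simp add: \<eta>_def add_nonneg_pos)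
  have "\<eta> * (- b) < \<eta> * (\<bar>b\<bar> + 1)"
    using \<eta> by (intro mult_strict_left_mono) auto
  also have "\<dots> = \<delta>"
    by (simp add: \<eta>_def add_nonneg_pos less_imp_neq[symmetric])
  finally show "0 < \<delta> + \<eta> * b" by simp
qed

text \<open>
  A separating hyperplane with \<open>\<beta> > 0\<close> is the graph of an affine function: solve for \<open>s\<close>.
\<close>

lemma affine_minorant_of_nonvertical_separation:
  assumes g: "g \<in> lsc_proper_convex" and \<psi>: "\<psi> \<in> dual_space" and \<beta>: "0 < \<beta>"
    and ineq: "\<And>y s. g y \<le> ereal s \<Longrightarrow> \<delta> \<le> \<psi> y - \<psi> x + \<beta> * (s - c)"
    and pos: "0 < \<delta>"
  obtains h s where "(h, s) \<in> epi_conjugate g" "c < h x - s"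
proof
  define h where "h y = (- 1 / \<beta>) * \<psi> y" for y
  define s where "s = h x - c - \<delta> / \<beta>"
  have "h \<in> dual_space"
    unfolding h_def using \<psi> by (rule dual_space_scale)
  moreover have "ereal (h y - s) \<le> g y" for y
  proof (cases "g y")
    case (real t)
    then have "\<delta> / \<beta> \<le> (\<psi> y - \<psi> x + \<beta> * (t - c)) / \<beta>"
      using ineq[of y t] \<beta> by (intro divide_right_mono) auto
    also have "\<dots> = h x - h y + (t - c)"
      using \<beta> by (simp add: h_def field_simps)
    finally show ?thesis
      using real by (simp add: s_def)
  qed (use not_MInf[OF g, of y] in auto)
  ultimately show "(h, s) \<in> epi_conjugate g"
    by (simp add: mem_epi_conjugate)
  show "c < h x - s"
    using pos \<beta> by (simp add: s_def)
qed

text \<open>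
  Separation below a point where \<open>g\<close> is finite is automatically nonvertical, because the epigraph
  meets the vertical line through that point.
\<close>

lemma ex_affine_minorant:
  assumes g: "g \<in> lsc_proper_convex"
  obtains h s where "(h, s) \<in> epi_conjugate g"
proof -
  obtain x a where x: "g x = ereal a"
    by (rule ex_finite_value[OF g])
  obtain \<psi> \<alpha> \<delta> where sep: "\<psi> \<in> dual_space" "0 \<le> \<alpha>" "0 < \<delta>"
    "\<And>y s. g y \<le> ereal s \<Longrightarrow> \<delta> \<le> \<psi> y - \<psi> x + \<alpha> * (s - (a - 1))"
    by (rule separate_point_from_epigraph[OF g, of "a - 1" x]) (auto simp: x)
  have "0 < \<alpha>"
    using sep(4)[of x a] sep(3) x by simp
  from affine_minorant_of_nonvertical_separation[OF g sep(1) this sep(4) sep(3)] that show thesis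
    by blast
qed

text \<open>
  The nontrivial half of the Fenchel--Moreau theorem. A vertical separating hyperplane is tilted by
  adding a small multiple \<open>\<eta>\<close> of the inequality given by any continuous affine minorant.
\<close>

lemma affine_minorant_approximates:
  assumes g: "g \<in> lsc_proper_convex" and c: "ereal c < g x"
  obtains h s where "(h, s) \<in> epi_conjugate g" "c < h x - s"
proof -
  obtain h0 s0 where "(h0, s0) \<in> epi_conjugate g"
    using ex_affine_minorant[OF g] .
  then have h0: "h0 \<in> dual_space" "\<And>y. ereal (h0 y - s0) \<le> g y"
    by (auto simp: mem_epi_conjugate)
  obtain \<psi> \<alpha> \<delta> where sep: "\<psi> \<in> dual_space" "0 \<le> \<alpha>" "0 < \<delta>"
    "\<And>y s. g y \<le> ereal s \<Longrightarrow> \<delta> \<le> \<psi> y - \<psi> x + \<alpha> * (s - c)"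
    using separate_point_from_epigraph[OF g c] by blast
  define b where "b = h0 x - s0 - c"
  obtain \<eta> where \<eta>: "0 < \<eta>" "0 < \<delta> + \<eta> * b"
    using small_perturbation[OF sep(3)] .
  define \<psi>' where "\<psi>' y = \<psi> y - \<eta> * h0 y" for y
  have "\<psi>' \<in> dual_space"
    unfolding \<psi>'_def by (intro dual_space_diff dual_space_scale sep h0)
  moreover have "0 < \<alpha> + \<eta>"
    using sep(2) \<eta>(1) by simp
  moreover have "\<delta> + \<eta> * b \<le> \<psi>' y - \<psi>' x + (\<alpha> + \<eta>) * (s - c)" if "g y \<le> ereal s" for y s
  proof -
    have "h0 y - s0 \<le> s"
      using order_trans[OF h0(2) that] by simp
    then have "\<eta> * (h0 y - s0) \<le> \<eta> * s"
      using \<eta>(1) by simp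
    with sep(4)[OF that] show ?thesis
      by (simp add: \<psi>'_def b_def algebra_simps)
  qed
  ultimately show thesis
    using affine_minorant_of_nonvertical_separation[OF g _ _ _ \<eta>(2)] that by blast
qed


section \<open>Weak* separation\<close>

text \<open>
  The weak* topology is induced by the product topology on all real functions, so it is convenient to
  separate in the vector space of all functions: there, coordinates can be prescribed freely, and a
  functional depending on finitely many of them has a representing point by inspection.
\<close>

instantiation "fun" :: (type, real_vector) real_vector
begin

definition scaleR_fun_def: "c *\<^sub>R g = (\<lambda>x. c *\<^sub>R g x)"

instance
  by standard (simp_all add: scaleR_fun_def fun_eq_iff scaleR_add_right scaleR_add_left)

end

lemma scaleR_fun_apply [simp]: "(c *\<^sub>R g) x = c *\<^sub>R g x"
  by (simp add: scaleR_fun_def)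

text \<open>
  Product neighbourhoods restrict only finitely many coordinates, so one \<open>\<epsilon>\<close> serves for all of them.
\<close>

lemma dual_times_real_basic_neighbourhood:
  assumes T: "openin dual_times_real T" "(h0, r) \<in> T"
  obtains S \<epsilon> where "finite S" "0 < \<epsilon>"
    "\<And>h s. h \<in> dual_space \<Longrightarrow> \<forall>x\<in>S. \<bar>h x - h0 x\<bar> < \<epsilon> \<Longrightarrow> \<bar>s - r\<bar> < \<epsilon> \<Longrightarrow> (h, s) \<in> T"
proof -
  obtain U V where U: "openin weak_star U" "h0 \<in> U" and V: "open V" "r \<in> V" and UV: "U \<times> V \<subseteq> T"
    using T unfolding dual_times_real_def openin_prod_topology_alt by (metis open_openin)
  obtain U' where U': "openin (powertop_real UNIV) U'" "U = U' \<inter> dual_space"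
    using U(1) by (auto simp: weak_star_def openin_subtopology)
  have "h0 \<in> U'" using U U' by simp
  then obtain B where B: "finite {x. B x \<noteq> (UNIV :: real set)}" "\<And>x. open (B x)" "\<And>x. h0 x \<in> B x"
      "\<And>h. (\<forall>x. h x \<in> B x) \<Longrightarrow> h \<in> U'"
    using U'(1) unfolding openin_product_topology_alt by (fastforce simp: PiE_iff subset_iff)
  define S where "S = {x. B x \<noteq> (UNIV :: real set)}"
  have "\<exists>e>0. \<forall>t. \<bar>t - h0 x\<bar> < e \<longrightarrow> t \<in> B x" for x
    using B(2,3) by (metis open_dist dist_real_def)
  then obtain e where e: "\<And>x. e x > (0::real)" "\<And>x t. \<bar>t - h0 x\<bar> < e x \<Longrightarrow> t \<in> B x"
    by metis
  obtain d where d: "d > 0" "\<And>t. \<bar>t - r\<bar> < d \<Longrightarrow> t \<in> V"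
    using V by (metis open_dist dist_real_def)
  show thesis
  proof
    show fin: "finite S" using B(1) by (simp add: S_def)
    show "0 < Min (insert d (e ` S))"
      using fin e d by simp
    show "(h, s) \<in> T"
      if "h \<in> dual_space" "\<forall>x\<in>S. \<bar>h x - h0 x\<bar> < Min (insert d (e ` S))"
        "\<bar>s - r\<bar> < Min (insert d (e ` S))" for h s
    proof -
      have "h x \<in> B x" for x
      proof (cases "x \<in> S")
        case True
        then show ?thesis using that(2) fin by (intro e) auto
      qed (simp add: S_def)
      then have "h \<in> U"
        using B(4) that(1) U'(2) by blast
      moreover have "s \<in> V"
        using that(3) fin by (intro d) simp
      ultimately show ?thesis using UV by blast
    qed
  qed
qed

text \<open>
  The weak* dual of the dual is the original space. Being bounded on a strip around finitely many
  coordinates, \<open>\<phi>\<close> is bounded on the subspace where these coordinates vanish, hence zero there. So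
  \<open>\<phi> (h, 0)\<close> is a linear combination of the values \<open>h x\<close> for \<open>x \<in> S\<close>, and for linear \<open>h\<close> it is the value
  of \<open>h\<close> at the corresponding combination of points.
\<close>

lemma functional_on_finite_coordinates:
  fixes \<phi> :: "('a::real_vector \<Rightarrow> real) \<times> real \<Rightarrow> real"
  assumes lin: "linear \<phi>" and S: "finite S" and "0 < \<epsilon>"
    and bound: "\<And>h s. \<forall>x\<in>S. \<bar>h x\<bar> < \<epsilon> \<Longrightarrow> \<bar>s\<bar> < \<epsilon> \<Longrightarrow> \<phi> (h, s) \<le> K"
  obtains x \<alpha> where "\<And>h s. linear h \<Longrightarrow> \<phi> (h, s) = h x + \<alpha> * s"
proof
  define e where "e x = (\<lambda>y. if y = x then 1 else 0 :: real)" for x :: 'a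
  define x0 where "x0 = (\<Sum>x\<in>S. \<phi> (e x, 0) *\<^sub>R x)"
  have vanish: "\<phi> (g, 0) = 0" if g: "\<forall>x\<in>S. g x = 0" for g
  proof (rule ccontr)
    assume nz: "\<phi> (g, 0) \<noteq> 0"
    define t where "t = (K + 1) / \<phi> (g, 0)"
    have "\<phi> (t *\<^sub>R g, 0) \<le> K"
      using g \<open>0 < \<epsilon>\<close> by (intro bound) auto
    moreover have "\<phi> (t *\<^sub>R g, 0) = t * \<phi> (g, 0)"
      using linear_scale[OF lin, of t "(g, 0)"] by simp
    ultimately show False using nz by (simp add: t_def)
  qed
  fix h :: "'a \<Rightarrow> real" and s assume h: "linear h"
  define g where "g = (\<Sum>x\<in>S. h x *\<^sub>R e x)"
  have g_apply: "g y = (\<Sum>x\<in>S. h x * e x y)" for y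
    unfolding g_def using S by (induction S) auto
  have "\<phi> (h - g, 0) = 0"
    using S by (intro vanish) (simp add: g_apply e_def if_distrib sum.delta cong: if_cong)
  then have "\<phi> (h, 0) = \<phi> (g, 0)"
    using linear_diff[OF lin, of "(h, 0)" "(g, 0)"] by simp
  also have "(g, 0::real) = (\<Sum>x\<in>S. h x *\<^sub>R (e x, 0))"
    by (simp add: g_def prod_eq_iff fst_sum snd_sum)
  also have "\<phi> \<dots> = (\<Sum>x\<in>S. h x * \<phi> (e x, 0))"
    unfolding linear_sum[OF lin] by (simp only: linear_scale[OF lin] real_scaleR_def)
  also have "\<dots> = h x0"
    by (simp add: x0_def linear_sum[OF h] linear_scale[OF h] mult.commute)
  finally have "\<phi> (h, 0) = h x0" .
  moreover have "\<phi> (h, s) = \<phi> (h, 0) + s * \<phi> (0, 1)"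
    using linear_add[OF lin, of "(h, 0)" "s *\<^sub>R (0, 1)"] linear_scale[OF lin, of s "(0, 1)"]
    by simp
  ultimately show "\<phi> (h, s) = h x0 + \<phi> (0, 1) * s" by simp
qed

lemma weak_star_separation:
  fixes A :: "(('a::locally_convex_space \<Rightarrow> real) \<times> real) set"
  assumes A: "A \<subseteq> dual_space \<times> UNIV" "convex A" "A \<noteq> {}" and h0: "h0 \<in> dual_space"
    and notin: "(h0, r) \<notin> dual_times_real closure_of A"
  obtains x \<alpha> \<delta> where "0 < \<delta>" "\<And>h s. (h, s) \<in> A \<Longrightarrow> \<delta> \<le> h x - h0 x + \<alpha> * (s - r)"
proof -
  have "(h0, r) \<in> topspace dual_times_real"
    using h0 by (simp add: dual_times_real_def weak_star_def)
  then obtain T where T: "openin dual_times_real T" "(h0, r) \<in> T" "A \<inter> T = {}"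
    using notin unfolding in_closure_of by blast
  obtain S \<epsilon> where S: "finite S" "0 < \<epsilon>"
    "\<And>h s. h \<in> dual_space \<Longrightarrow> \<forall>x\<in>S. \<bar>h x - h0 x\<bar> < \<epsilon> \<Longrightarrow> \<bar>s - r\<bar> < \<epsilon> \<Longrightarrow> (h, s) \<in> T"
    using dual_times_real_basic_neighbourhood[OF T(1,2)] by metis
  define C where "C = (+) (- (h0, r)) ` A"
  define W where "W = {h. \<forall>x\<in>S. \<bar>h x\<bar> < \<epsilon>} \<times> {s. \<bar>s\<bar> < \<epsilon>}"
  have CI: "(h - h0, s - r) \<in> C" if "(h, s) \<in> A" for h s
    unfolding C_def using that by (intro image_eqI[of _ _ "(h, s)"]) auto
  have strip: "convex {h :: 'a \<Rightarrow> real. \<forall>x\<in>S. \<bar>h x\<bar> < \<epsilon>}"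
    using convex_abs_less[of \<epsilon>] by (auto simp: convex_def)
  have "convex C"
    unfolding C_def by (intro convex_translation A)
  moreover have "C \<noteq> {}"
    using A(3) by (simp add: C_def)
  moreover have "convex W"
    unfolding W_def by (intro convex_Times strip convex_abs_less)
  moreover have "absorbing W"
    unfolding W_def
  proof (intro absorbing_Times strip convex_abs_less absorbing_abs_less S)
    show "absorbing {h :: 'a \<Rightarrow> real. \<forall>x\<in>S. \<bar>h x\<bar> < \<epsilon>}"
      unfolding absorbing_def
    proof
      fix g :: "'a \<Rightarrow> real"
      define M where "M = (\<Sum>x\<in>S. \<bar>g x\<bar>)"
      have M: "\<bar>g x\<bar> \<le> M" if "x \<in> S" for x
        unfolding M_def using S(1) that by (intro member_le_sum) auto
      have M0: "0 \<le> M" by (simp add: M_def sum_nonneg)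
      have "\<epsilon> / (M + 1) * \<bar>g x\<bar> < \<epsilon>" if "x \<in> S" for x
      proof -
        have "\<epsilon> * \<bar>g x\<bar> < \<epsilon> * (M + 1)"
          using M[OF that] S(2) by (intro mult_strict_left_mono) auto
        then show ?thesis using M0 by (simp add: field_simps)
      qed
      then show "\<exists>e>0. e *\<^sub>R g \<in> {h. \<forall>x\<in>S. \<bar>h x\<bar> < \<epsilon>}"
        using S(2) M0 by (intro exI[of _ "\<epsilon> / (M + 1)"]) (simp add: abs_mult)
    qed
  qed
  moreover have "C \<inter> W = {}"
  proof -
    have False if "(h, s) \<in> A" "\<forall>x\<in>S. \<bar>h x - h0 x\<bar> < \<epsilon>" "\<bar>s - r\<bar> < \<epsilon>" for h s
      using S(3)[OF _ that(2,3)] that(1) A(1) T(3) by auto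
    then show ?thesis by (auto simp: C_def W_def)
  qed
  ultimately obtain \<phi> :: "_ \<Rightarrow> real" and \<delta> K where \<phi>: "linear \<phi>" "0 < \<delta>" "\<And>p. p \<in> C \<Longrightarrow> \<delta> \<le> \<phi> p"
    "\<And>p. p \<in> W \<Longrightarrow> \<phi> p \<le> K"
    using separate_convex_from_absorbing[of C W] by metis
  obtain x \<alpha> where x: "\<And>h s. linear h \<Longrightarrow> \<phi> (h, s) = h x + \<alpha> * s"
    by (rule functional_on_finite_coordinates[OF \<phi>(1) S(1,2), of K]) (auto intro!: \<phi>(4) simp: W_def)
  show thesis
  proof (rule that[OF \<phi>(2)])
    fix h s assume hs: "(h, s) \<in> A"
    then have "linear (h - h0)"
      using A(1) dual_space_diff[OF _ h0, of h] by (auto simp: dual_space_def fun_diff_def)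
    then show "\<delta> \<le> h x - h0 x + \<alpha> * (s - r)"
      using \<phi>(3)[OF CI[OF hs]] x by simp
  qed
qed

section \<open>Lagrangians\<close>

text \<open>
  Unlike \<^const>\<open>lsc_proper_convex\<close>, this class admits the constant \<open>\<infinity>\<close> and is therefore closed under
  sums of functions with disjoint domains. Properness of a Lagrangian is a separate matter, settled by a
  feasible point.
\<close>

definition closed_convex :: "('a::locally_convex_space \<Rightarrow> ereal) set" where
  "closed_convex = {g. (\<forall>x. g x \<noteq> - \<infinity>) \<and> lsc_fun g \<and> convex_fun g}"

lemma lsc_proper_convex_iff: "g \<in> lsc_proper_convex \<longleftrightarrow> g \<in> closed_convex \<and> (\<exists>x. g x \<noteq> \<infinity>)"
  by (auto simp: lsc_proper_convex_def closed_convex_def proper_fun_def)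

lemma convex_fun_iff:
  "convex_fun g \<longleftrightarrow> (\<forall>x y a b u v. g x \<le> ereal a \<longrightarrow> g y \<le> ereal b \<longrightarrow> 0 \<le> u \<longrightarrow> 0 \<le> v \<longrightarrow> u + v = 1 \<longrightarrow>
     g (u *\<^sub>R x + v *\<^sub>R y) \<le> ereal (u * a + v * b))"
  by (auto simp: convex_fun_def convex_def)

lemma closed_convex_add:
  assumes g: "g \<in> closed_convex" and h: "h \<in> closed_convex"
  shows "(\<lambda>x. g x + h x) \<in> closed_convex"
proof -
  have gM: "g x \<noteq> - \<infinity>" and hM: "h x \<noteq> - \<infinity>" for x
    using g h by (auto simp: closed_convex_def)
  have "lsc_fun (\<lambda>x. g x + h x)"
    unfolding lsc_fun_def
  proof (intro allI impI)
    fix x c assume c: "c < g x + h x"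
    show "\<forall>\<^sub>F y in nhds x. c < g y + h y"
    proof (cases c)
      case (real t)
      obtain a b where ab: "ereal a < g x" "ereal b < h x" "t \<le> a + b"
      proof (cases "g x = \<infinity>")
        case True
        obtain b where "ereal b < h x"
          using hM[of x] ereal_dense2[of "- \<infinity>" "h x"] by auto
        with True show thesis by (intro that[of "t - b" b]) auto
      next
        case False
        then obtain p where p: "g x = ereal p" using gM[of x] by (cases "g x") auto
        show thesis
        proof (cases "h x = \<infinity>")
          case True
          with p show thesis by (intro that[of "p - 1" "t - (p - 1)"]) auto
        next
          case False
          then obtain q where q: "h x = ereal q" using hM[of x] by (cases "h x") auto
          with p c real show thesis
            by (intro that[of "p - (p + q - t) / 2" "q - (p + q - t) / 2"]) (auto simp: field_simps)
        qed
      qed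
      have "\<forall>\<^sub>F y in nhds x. ereal a < g y" "\<forall>\<^sub>F y in nhds x. ereal b < h y"
        using g h ab by (auto simp: closed_convex_def lsc_fun_def)
      then show ?thesis
      proof eventually_elim
        case (elim y)
        then have "ereal (a + b) < g y + h y"
          by (cases "g y"; cases "h y") auto
        with ab(3) real show ?case
          by (metis ereal_less_eq(3) order_le_less_trans)
      qed
    next
      case MInf
      have "- \<infinity> < g y + h y" for y
        using gM[of y] hM[of y] by (cases "g y"; cases "h y") auto
      with MInf show ?thesis by simp
    qed (use c in auto)
  qed
  moreover have "convex_fun (\<lambda>x. g x + h x)"
    unfolding convex_fun_iff
  proof (intro allI impI)
    fix x y a b and u v :: real
    assume x: "g x + h x \<le> ereal a" and y: "g y + h y \<le> ereal b"
      and uv: "0 \<le> u" "0 \<le> v" "u + v = 1"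
    obtain a1 a2 where a: "g x = ereal a1" "h x = ereal a2" "a1 + a2 \<le> a"
      using x gM[of x] hM[of x] by (cases "g x"; cases "h x") auto
    obtain b1 b2 where b: "g y = ereal b1" "h y = ereal b2" "b1 + b2 \<le> b"
      using y gM[of y] hM[of y] by (cases "g y"; cases "h y") auto
    have "g (u *\<^sub>R x + v *\<^sub>R y) \<le> ereal (u * a1 + v * b1)"
      using g uv a b by (simp add: closed_convex_def convex_fun_iff)
    moreover have "h (u *\<^sub>R x + v *\<^sub>R y) \<le> ereal (u * a2 + v * b2)"
      using h uv a b by (simp add: closed_convex_def convex_fun_iff)
    ultimately have "g (u *\<^sub>R x + v *\<^sub>R y) + h (u *\<^sub>R x + v *\<^sub>R y)
        \<le> ereal (u * a1 + v * b1) + ereal (u * a2 + v * b2)"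
      by (rule add_mono)
    also have "\<dots> = ereal (u * (a1 + a2) + v * (b1 + b2))"
      by (simp add: algebra_simps)
    also have "\<dots> \<le> ereal (u * a + v * b)"
      using uv a b by (simp add: add_mono mult_left_mono)
    finally show "g (u *\<^sub>R x + v *\<^sub>R y) + h (u *\<^sub>R x + v *\<^sub>R y) \<le> ereal (u * a + v * b)" .
  qed
  moreover have "g x + h x \<noteq> - \<infinity>" for x
    using gM[of x] hM[of x] by auto
  ultimately show ?thesis by (simp add: closed_convex_def)
qed

lemma closed_convex_zero: "(\<lambda>x. 0) \<in> closed_convex"
  by (auto simp: closed_convex_def lsc_fun_def convex_fun_iff zero_ereal_def)

lemma closed_convex_scale:
  assumes g: "g \<in> closed_convex" and "0 \<le> c"
  shows "(\<lambda>x. ereal c * g x) \<in> closed_convex"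
proof (cases "c = 0")
  case True
  then show ?thesis using closed_convex_zero by (simp flip: zero_ereal_def)
next
  case False
  with \<open>0 \<le> c\<close> have c: "0 < c" by simp
  have less: "ereal t < ereal c * y \<longleftrightarrow> ereal (t / c) < y" for t y
    using c by (cases y) (auto simp: field_simps)
  have le: "ereal c * y \<le> ereal t \<longleftrightarrow> y \<le> ereal (t / c)" for t y
    using less[of t y] by (simp flip: not_less)
  have gM: "g x \<noteq> - \<infinity>" for x
    using g by (auto simp: closed_convex_def)
  have nM: "ereal c * g x \<noteq> - \<infinity>" for x
    using c gM[of x] by (cases "g x") auto
  have "lsc_fun (\<lambda>x. ereal c * g x)"
    unfolding lsc_fun_def
  proof (intro allI impI)
    fix x t assume "t < ereal c * g x"
    then show "\<forall>\<^sub>F y in nhds x. t < ereal c * g y"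
      using g nM by (cases t) (auto simp: less closed_convex_def lsc_fun_def)
  qed
  moreover have "convex_fun (\<lambda>x. ereal c * g x)"
    using g by (auto simp: closed_convex_def convex_fun_iff le add_divide_distrib)
      (metis times_divide_eq_right)
  ultimately show ?thesis using nM by (simp add: closed_convex_def)
qed

lemma closed_convex_sum:
  "finite K \<Longrightarrow> (\<And>k. k \<in> K \<Longrightarrow> g k \<in> closed_convex) \<Longrightarrow> (\<lambda>x. \<Sum>k\<in>K. g k x) \<in> closed_convex"
  by (induction K rule: finite_induct) (auto intro: closed_convex_zero closed_convex_add)

lemma lagrangian_le_objective:
  assumes "\<And>k. k \<in> K \<Longrightarrow> 0 \<le> l k" "\<And>k. k \<in> K \<Longrightarrow> fs k x \<le> 0"
  shows "lagrangian f fs K l x \<le> f x"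
proof -
  have "ereal (l k) * fs k x \<le> 0" if "k \<in> K" for k
    using ereal_mult_left_mono[of "fs k x" 0 "ereal (l k)"] assms that by simp
  then have "(\<Sum>k\<in>K. ereal (l k) * fs k x) \<le> 0"
    by (rule sum_nonpos)
  then show ?thesis
    unfolding lagrangian_def using add_left_mono by fastforce
qed

lemma lagrangian_lsc_proper_convex:
  assumes "f \<in> lsc_proper_convex" "finite K" "\<And>k. k \<in> K \<Longrightarrow> fs k \<in> lsc_proper_convex"
    and l: "\<And>k. k \<in> K \<Longrightarrow> 0 \<le> l k" and x: "f x \<noteq> \<infinity>" "\<And>k. k \<in> K \<Longrightarrow> fs k x \<le> 0"
  shows "lagrangian f fs K l \<in> lsc_proper_convex"
proof -
  have "lagrangian f fs K l x \<noteq> \<infinity>"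
    using lagrangian_le_objective[of K l fs x f] l x by auto
  moreover have "lagrangian f fs K l \<in> closed_convex"
    unfolding lagrangian_def using assms
    by (intro closed_convex_add closed_convex_sum closed_convex_scale) (auto simp: lsc_proper_convex_iff)
  ultimately show ?thesis by (auto simp: lsc_proper_convex_iff)
qed

lemma lagrangian_support:
  assumes "finite K" "{k. l k \<noteq> 0} \<subseteq> K"
  shows "lagrangian f fs {k. l k \<noteq> 0} l = lagrangian f fs K l"
  using assms unfolding lagrangian_def
  by (intro ext arg_cong2[where f = "(+)"] refl sum.mono_neutral_left) (auto simp flip: zero_ereal_def)

lemma lagrangian_cong:
  "(\<And>k. k \<in> K \<Longrightarrow> l k = l' k) \<Longrightarrow> lagrangian f fs K l = lagrangian f fs K l'"
  by (auto simp: lagrangian_def fun_eq_iff intro!: arg_cong2[where f = "(+)"] sum.cong)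

lemma lagrangian_finite:
  assumes "f x = ereal a" "\<And>k. k \<in> K \<Longrightarrow> l k \<noteq> 0 \<Longrightarrow> \<bar>fs k x\<bar> \<noteq> \<infinity>"
  shows "lagrangian f fs K l x = ereal (a + (\<Sum>k\<in>K. l k * real_of_ereal (fs k x)))"
proof -
  have "ereal (l k) * fs k x = ereal (l k * real_of_ereal (fs k x))" if "k \<in> K" for k
    using assms(2)[OF that] by (cases "fs k x"; cases "l k = 0") (auto simp flip: zero_ereal_def)
  then show ?thesis
    by (simp add: lagrangian_def assms(1))
qed

text \<open>
  For fixed \<open>x\<close> the Lagrangian is affine in the multiplier wherever it is finite. With \<open>u, v > 0\<close> the
  support of the combination is the union of the supports, so that an infinite constraint value that
  counts for \<open>l\<close> or \<open>l'\<close> also counts for the combination; this is how the convention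
  \<open>0 \<cdot> \<infinity> = 0\<close> stays harmless.
\<close>

lemma lagrangian_concave_in_multiplier:
  assumes K: "finite K" and fM: "f x \<noteq> - \<infinity>" and fsM: "\<And>k. k \<in> K \<Longrightarrow> fs k x \<noteq> - \<infinity>"
    and l: "\<And>k. k \<in> K \<Longrightarrow> 0 \<le> l k" and l': "\<And>k. k \<in> K \<Longrightarrow> 0 \<le> l' k"
    and uv: "0 < u" "0 < v"
    and le: "ereal a \<le> lagrangian f fs K l x" "ereal a' \<le> lagrangian f fs K l' x" and sum1: "u + v = 1"
  shows "ereal (u * a + v * a') \<le> lagrangian f fs K (\<lambda>k. u * l k + v * l' k) x"
    (is "_ \<le> lagrangian f fs K ?m x")
proof -
  have pos: "0 < ?m k" if "k \<in> K" "l k \<noteq> 0 \<or> l' k \<noteq> 0" for k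
    using l[OF that(1)] l'[OF that(1)] that(2) uv
    by (smt (verit) mult_nonneg_nonneg mult_pos_pos)
  consider (f) "f x = \<infinity>" | (fs) k where "k \<in> K" "?m k \<noteq> 0" "fs k x = \<infinity>"
    | (fin) b where "f x = ereal b" "\<And>k. k \<in> K \<Longrightarrow> ?m k \<noteq> 0 \<Longrightarrow> \<bar>fs k x\<bar> \<noteq> \<infinity>"
    using fM fsM by (cases "f x") auto
  then show ?thesis
  proof cases
    case fs
    then have "0 < ?m k" using pos[of k] by fastforce
    then have "ereal (?m k) * fs k x = \<infinity>"
      using fs by simp
    then have "(\<Sum>k\<in>K. ereal (?m k) * fs k x) = \<infinity>"
      using fs(1) K unfolding sum_Pinfty by blast
    then show ?thesis by (simp add: lagrangian_def)
  next
    case fin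
    define R where "R k = real_of_ereal (fs k x)" for k
    have m0: "?m k \<noteq> 0" if "k \<in> K" "l k \<noteq> 0 \<or> l' k \<noteq> 0" for k
      using pos[OF that] by simp
    have "a \<le> b + (\<Sum>k\<in>K. l k * R k)"
      using le(1) lagrangian_finite[of f x b K l fs] fin m0 by (simp add: R_def)
    moreover have "a' \<le> b + (\<Sum>k\<in>K. l' k * R k)"
      using le(2) lagrangian_finite[of f x b K l' fs] fin m0 by (simp add: R_def)
    ultimately have "u * a + v * a' \<le> u * (b + (\<Sum>k\<in>K. l k * R k)) + v * (b + (\<Sum>k\<in>K. l' k * R k))"
      using uv by (intro add_mono mult_left_mono) auto
    also have "\<dots> = (u + v) * b + (\<Sum>k\<in>K. ?m k * R k)"
      by (simp add: algebra_simps sum.distrib sum_distrib_left)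
    finally show ?thesis
      using lagrangian_finite[of f x b K ?m fs] fin sum1 by (simp add: R_def)
  qed (simp add: lagrangian_def)
qed


section \<open>The set of affine minorants of the Lagrangians\<close>

lemma finite_support_multipliersD:
  assumes "l \<in> finite_support_multipliers"
  shows "finite {k. l k \<noteq> 0}" "0 \<le> l k" "l k \<noteq> 0 \<Longrightarrow> 1 \<le> k"
  using assms by (auto simp: finite_support_multipliers_def Suc_le_eq intro: gr0I)

lemma mem_characteristic_set:
  "(h, s) \<in> characteristic_set f fs \<longleftrightarrow> h \<in> dual_space \<and>
     (\<exists>l\<in>finite_support_multipliers. \<forall>x. ereal (h x - s) \<le> lagrangian f fs {k. l k \<noteq> 0} l x)"
  by (auto simp: characteristic_set_def mem_epi_conjugate)

lemma zero_mem_dual_space: "(\<lambda>_. 0) \<in> dual_space"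
  by (simp add: dual_space_def linear_zero)

lemma convex_characteristic_set:
  assumes f: "f \<in> lsc_proper_convex" and fs: "\<And>k. 1 \<le> k \<Longrightarrow> fs k \<in> lsc_proper_convex"
  shows "convex (characteristic_set f fs)"
  unfolding convex_alt
proof (intro ballI allI impI)
  fix p q and v :: real
  assume p: "p \<in> characteristic_set f fs" and q: "q \<in> characteristic_set f fs" and v: "0 \<le> v \<and> v \<le> 1"
  obtain h s where [simp]: "p = (h, s)" by (cases p)
  obtain h' s' where [simp]: "q = (h', s')" by (cases q)
  show "(1 - v) *\<^sub>R p + v *\<^sub>R q \<in> characteristic_set f fs"
  proof (cases "v = 0 \<or> v = 1")
    case True
    with p q show ?thesis by (elim disjE) (simp_all add: zero_prod_def)
  next
    case False
    with v have uv: "0 < 1 - v" "0 < v" by auto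
    obtain l where l: "h \<in> dual_space" "l \<in> finite_support_multipliers"
      "\<And>x. ereal (h x - s) \<le> lagrangian f fs {k. l k \<noteq> 0} l x"
      using p by (auto simp: mem_characteristic_set)
    obtain l' where l': "h' \<in> dual_space" "l' \<in> finite_support_multipliers"
      "\<And>x. ereal (h' x - s') \<le> lagrangian f fs {k. l' k \<noteq> 0} l' x"
      using q by (auto simp: mem_characteristic_set)
    define m where "m k = (1 - v) * l k + v * l' k" for k
    define K where "K = {k. l k \<noteq> 0} \<union> {k. l' k \<noteq> 0}"
    have K: "finite K" "\<And>k. k \<in> K \<Longrightarrow> 1 \<le> k"
      using finite_support_multipliersD[OF l(2)] finite_support_multipliersD[OF l'(2)]
      by (auto simp: K_def)
    have m_supp: "{k. m k \<noteq> 0} \<subseteq> K"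
      by (auto simp: m_def K_def)
    have "m \<in> finite_support_multipliers"
      using l(2) l'(2) uv finite_subset[OF m_supp K(1)]
      by (auto simp: finite_support_multipliers_def m_def)
    moreover have "ereal ((1 - v) * (h x - s) + v * (h' x - s')) \<le> lagrangian f fs {k. m k \<noteq> 0} m x" for x
    proof -
      have "ereal ((1 - v) * (h x - s) + v * (h' x - s')) \<le> lagrangian f fs K m x"
        unfolding m_def
      proof (rule lagrangian_concave_in_multiplier[OF K(1)])
        show "ereal (h x - s) \<le> lagrangian f fs K l x"
          using l(3)[of x] lagrangian_support[of K l f fs] K by (simp add: K_def)
        show "ereal (h' x - s') \<le> lagrangian f fs K l' x"
          using l'(3)[of x] lagrangian_support[of K l' f fs] K by (simp add: K_def)
      qed (use uv finite_support_multipliersD(2) l l' K not_MInf[OF f] not_MInf[OF fs] in auto)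
      then show ?thesis
        by (simp add: lagrangian_support[OF K(1) m_supp])
    qed
    moreover have "(1 - v) *\<^sub>R h + v *\<^sub>R h' \<in> dual_space"
      using dual_space_diff[OF dual_space_scale[OF l(1), of "1 - v"] dual_space_scale[OF l'(1), of "- v"]]
      by (simp add: scaleR_fun_def plus_fun_def)
    ultimately show ?thesis
      by (auto simp: mem_characteristic_set algebra_simps intro!: bexI[of _ m])
  qed
qed

lemma lagrangian_of_multiplier_lsc_proper_convex:
  assumes "f \<in> lsc_proper_convex" "\<And>k. 1 \<le> k \<Longrightarrow> fs k \<in> lsc_proper_convex"
    and "f x \<noteq> \<infinity>" "\<And>k. 1 \<le> k \<Longrightarrow> fs k x \<le> 0" and "l \<in> finite_support_multipliers"
  shows "lagrangian f fs {k. l k \<noteq> 0} l \<in> lsc_proper_convex"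
  using assms finite_support_multipliersD[OF assms(5)]
  by (intro lagrangian_lsc_proper_convex[where x = x]) auto

text \<open>
  The supremum of the Lagrangians over all multipliers is \<open>f\<close> on the feasible set and \<open>\<infinity>\<close> elsewhere.
  It suffices to look at \<open>l = 0\<close> and at large multiples of a single constraint.
\<close>

lemma feasible_if_lagrangians_bounded:
  assumes f: "f \<in> lsc_proper_convex" and fs: "\<And>k. 1 \<le> k \<Longrightarrow> fs k \<in> lsc_proper_convex"
    and bound: "\<And>l. l \<in> finite_support_multipliers \<Longrightarrow> lagrangian f fs {k. l k \<noteq> 0} l x \<le> ereal M"
  shows "f x \<le> ereal M" "1 \<le> k \<Longrightarrow> fs k x \<le> 0"
proof -
  show fx: "f x \<le> ereal M"
    using bound[of "\<lambda>_. 0"] by (simp add: finite_support_multipliers_def lagrangian_def)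
  then obtain a where a: "f x = ereal a"
    using not_MInf[OF f, of x] by (cases "f x") auto
  assume k: "1 \<le> k"
  have pen: "ereal a + ereal t * fs k x \<le> ereal M" if t: "0 < t" for t
  proof -
    define l where "l j = (if j = k then t else 0)" for j
    have supp: "{j. l j \<noteq> 0} = {k}"
      using t by (auto simp: l_def)
    have "l \<in> finite_support_multipliers"
      using k t supp by (simp add: finite_support_multipliers_def) (simp add: l_def)
    from bound[OF this] show ?thesis
      unfolding supp by (simp add: lagrangian_def a l_def)
  qed
  show "fs k x \<le> 0"
  proof (rule ccontr)
    assume pos: "\<not> fs k x \<le> 0"
    then obtain b where b: "fs k x = ereal b" "0 < b"
      using pen[of 1] by (cases "fs k x") auto
    \<comment> \<open>The weight is chosen so that the penalty exceeds \<open>M - a\<close>.\<close>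
    have "a + (\<bar>M - a\<bar> + 1) / b * b \<le> M"
      using pen[of "(\<bar>M - a\<bar> + 1) / b"] b by simp
    with b show False by simp
  qed
qed

text \<open>
  The half-space cut out by a feasible point contains the characteristic set, and it is closed since
  evaluation at \<open>x\<close> is weak* continuous.
\<close>

lemma characteristic_set_closure_le:
  assumes cl: "(h, r) \<in> dual_times_real closure_of (characteristic_set f fs)"
    and fx: "f x = ereal a" and feas: "\<And>k. 1 \<le> k \<Longrightarrow> fs k x \<le> 0"
  shows "h x - r \<le> a"
proof -
  let ?C = "{p \<in> topspace dual_times_real. fst p x - snd p \<in> {..a}}"
  have "continuous_map dual_times_real euclideanreal (\<lambda>p. fst p x)"
  proof -
    have "continuous_map weak_star euclideanreal (\<lambda>h. h x)"
      unfolding weak_star_def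
      by (intro continuous_map_from_subtopology continuous_map_product_projection) simp
    from continuous_map_compose[OF continuous_map_fst this] show ?thesis
      by (simp add: dual_times_real_def o_def)
  qed
  moreover have "continuous_map dual_times_real euclideanreal snd"
    by (simp add: dual_times_real_def continuous_map_snd)
  ultimately have "continuous_map dual_times_real euclideanreal (\<lambda>p. fst p x - snd p)"
    by (intro continuous_intros)
  then have "closedin dual_times_real ?C"
    by (rule closedin_continuous_map_preimage) simp
  moreover have "characteristic_set f fs \<subseteq> ?C"
  proof
    fix p assume p: "p \<in> characteristic_set f fs"
    obtain h s where hs [simp]: "p = (h, s)" by (cases p)
    obtain l where l: "h \<in> dual_space" "l \<in> finite_support_multipliers"
      "ereal (h x - s) \<le> lagrangian f fs {k. l k \<noteq> 0} l x"
      using p by (auto simp: mem_characteristic_set)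
    have "lagrangian f fs {k. l k \<noteq> 0} l x \<le> f x"
      using finite_support_multipliersD[OF l(2)] feas by (intro lagrangian_le_objective) auto
    with l(3) have "ereal (h x - s) \<le> ereal a"
      unfolding fx by (rule order_trans)
    then show "p \<in> ?C"
      using l(1) by (simp add: dual_times_real_def weak_star_def)
  qed
  ultimately have "dual_times_real closure_of (characteristic_set f fs) \<subseteq> ?C"
    by (intro closure_of_minimal)
  then show ?thesis using cl by auto
qed

lemma inf_primal_le: "(\<And>k. 1 \<le> k \<Longrightarrow> fs k x \<le> 0) \<Longrightarrow> inf_primal f fs \<le> f x"
  unfolding inf_primal_def by (rule Inf_lower) auto

text \<open>
  This describes the trace of the closure on the vertical axis by the primal value. For the
  implication from right to left, the separating functional obtained from \<open>weak_star_separation\<close> may be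
  vertical (\<open>\<alpha> = 0\<close>). Every point \<open>z\<close> that is feasible with \<open>f z = a\<close> finite gives the inequality
  \<open>h z - s \<le> a\<close> on the characteristic set; adding \<open>\<eta>\<close> times this inequality makes the coefficient of
  \<open>s\<close> positive, and dividing by it produces the point \<open>y\<close> and the bound \<open>M\<close> of the overview.
\<close>

lemma zero_mem_closure_characteristic_set:
  assumes f: "f \<in> lsc_proper_convex" and fs: "\<And>k. 1 \<le> k \<Longrightarrow> fs k \<in> lsc_proper_convex"
    and fin: "inf_primal f fs \<noteq> \<infinity>"
  shows "(\<lambda>_. 0, r) \<in> dual_times_real closure_of (characteristic_set f fs)
    \<longleftrightarrow> ereal (- r) \<le> inf_primal f fs"
proof
  assume cl: "(\<lambda>_. 0, r) \<in> dual_times_real closure_of (characteristic_set f fs)"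
  show "ereal (- r) \<le> inf_primal f fs"
    unfolding inf_primal_def
  proof (rule Inf_greatest, clarify)
    fix x assume feas: "\<forall>k\<ge>1. fs k x \<le> 0"
    show "ereal (- r) \<le> f x"
    proof (cases "f x")
      case (real a)
      then show ?thesis
        using characteristic_set_closure_le[OF cl real] feas by simp
    qed (use not_MInf[OF f, of x] in auto)
  qed
next
  assume le: "ereal (- r) \<le> inf_primal f fs"
  let ?A = "characteristic_set f fs"
  obtain z where z: "f z \<noteq> \<infinity>" "\<And>k. 1 \<le> k \<Longrightarrow> fs k z \<le> 0"
  proof -
    have "\<exists>z. (\<forall>k\<ge>1. fs k z \<le> 0) \<and> f z \<noteq> \<infinity>"
    proof (rule ccontr)
      assume "\<not> ?thesis"
      then have "inf_primal f fs = \<infinity>"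
        unfolding inf_primal_def by (intro antisym Inf_greatest) auto
      with fin show False by simp
    qed
    then show thesis using that by blast
  qed
  then obtain a where a: "f z = ereal a"
    using not_MInf[OF f, of z] by (cases "f z") auto
  show "(\<lambda>_. 0, r) \<in> dual_times_real closure_of ?A"
  proof (rule ccontr)
    assume notin: "(\<lambda>_. 0, r) \<notin> dual_times_real closure_of ?A"
    obtain h0 s0 where hs0: "(h0, s0) \<in> ?A"
    proof -
      obtain h s where "(h, s) \<in> epi_conjugate f"
        using ex_affine_minorant[OF f] .
      then show thesis
        by (intro that[of h s])
          (auto simp: mem_characteristic_set mem_epi_conjugate finite_support_multipliers_def
            lagrangian_def intro!: exI[of _ "\<lambda>_. 0"])
    qed
    have up: "(h, s') \<in> ?A" if "(h, s) \<in> ?A" "s \<le> s'" for h s s'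
      using that by (fastforce simp: mem_characteristic_set elim: order_trans[rotated])
    have Az: "h z - s \<le> a" if "(h, s) \<in> ?A" for h s
    proof (rule characteristic_set_closure_le[where f = f and fs = fs, OF _ a z(2)])
      have "?A \<subseteq> topspace dual_times_real"
        by (auto simp: mem_characteristic_set dual_times_real_def weak_star_def)
      then show "(h, s) \<in> dual_times_real closure_of ?A"
        using that closure_of_subset by blast
    qed
    obtain x \<alpha> \<delta> where sep: "0 < \<delta>" "\<And>h s. (h, s) \<in> ?A \<Longrightarrow> \<delta> \<le> h x - 0 + \<alpha> * (s - r)"
    proof -
      have "?A \<subseteq> dual_space \<times> UNIV"
        by (auto simp: mem_characteristic_set)
      moreover have "?A \<noteq> {}"
        using hs0 by blast
      ultimately show thesis
        using weak_star_separation[OF _ convex_characteristic_set[OF f fs] _ zero_mem_dual_space notin]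
          that by metis
    qed
    \<comment> \<open>The characteristic set is unbounded upwards, so \<open>s\<close> can be made large.\<close>
    have \<alpha>: "0 \<le> \<alpha>"
    proof (rule ccontr)
      assume neg: "\<not> 0 \<le> \<alpha>"
      define s where "s = max s0 (r + h0 x / (- \<alpha>))"
      have "\<delta> \<le> h0 x + \<alpha> * (s - r)"
        using sep(2)[OF up[OF hs0, of s]] by (simp add: s_def)
      moreover have "\<alpha> * (s - r) \<le> \<alpha> * (h0 x / (- \<alpha>))"
        using neg by (intro mult_left_mono_neg) (auto simp: s_def)
      moreover have "\<alpha> * (h0 x / (- \<alpha>)) = - h0 x"
        using neg by simp
      ultimately show False using sep(1) by linarith
    qed
    obtain \<eta> where \<eta>: "0 < \<eta>" "0 < \<delta> + \<eta> * (- (a + r))"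
      using small_perturbation[OF sep(1)] .
    define \<beta> where "\<beta> = \<alpha> + \<eta>"
    define y where "y = (1 / \<beta>) *\<^sub>R (\<eta> *\<^sub>R z - x)"
    define M where "M = - r - (\<delta> - \<eta> * (a + r)) / \<beta>"
    have \<beta>: "0 < \<beta>" using \<alpha> \<eta> by (simp add: \<beta>_def)
    have minorants: "h y - s \<le> M" if hs: "(h, s) \<in> ?A" for h s
    proof -
      have h: "linear h"
        using hs by (simp add: mem_characteristic_set dual_space_def)
      have "\<eta> * (h z - s) \<le> \<eta> * a"
        using Az[OF hs] \<eta>(1) by simp
      then have "\<eta> * h z - h x - \<beta> * s \<le> \<eta> * a - \<delta> - \<alpha> * r"
        using sep(2)[OF hs] by (simp add: \<beta>_def algebra_simps)
      then have "(\<eta> * h z - h x - \<beta> * s) / \<beta> \<le> (\<eta> * a - \<delta> - \<alpha> * r) / \<beta>"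
        using \<beta> by (intro divide_right_mono) auto
      moreover have "(\<eta> * h z - h x - \<beta> * s) / \<beta> = h y - s"
        using \<beta> by (simp add: y_def linear_scale[OF h] linear_diff[OF h] field_simps)
      moreover have "(\<eta> * a - \<delta> - \<alpha> * r) / \<beta> = M"
        using \<beta> by (simp add: M_def field_simps) (simp add: \<beta>_def algebra_simps)
      ultimately show ?thesis by simp
    qed
    have bound: "lagrangian f fs {k. l k \<noteq> 0} l y \<le> ereal M" if l: "l \<in> finite_support_multipliers" for l
    proof (rule ccontr)
      assume "\<not> ?thesis"
      then have "ereal M < lagrangian f fs {k. l k \<noteq> 0} l y"
        by simp
      moreover have "lagrangian f fs {k. l k \<noteq> 0} l \<in> lsc_proper_convex"
        by (rule lagrangian_of_multiplier_lsc_proper_convex[OF f fs z l])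
      ultimately obtain h s
        where "(h, s) \<in> epi_conjugate (lagrangian f fs {k. l k \<noteq> 0} l)" "M < h y - s"
        using affine_minorant_approximates by blast
      with minorants[of h s] l show False
        by (fastforce simp: characteristic_set_def)
    qed
    have "inf_primal f fs \<le> f y"
      using feasible_if_lagrangians_bounded(2)[OF f fs bound] by (rule inf_primal_le)
    also have "f y \<le> ereal M"
      using feasible_if_lagrangians_bounded(1)[OF f fs bound] .
    also have "M < - r"
    proof -
      have "0 < (\<delta> - \<eta> * (a + r)) / \<beta>"
        using \<eta>(2) \<beta> by (intro divide_pos_pos) (auto simp: algebra_simps)
      then show ?thesis by (simp add: M_def)
    qed
    finally show False using le by (simp add: not_le)
  qed
qed

section \<open>Finite dual problems\<close>

lemma weak_duality:
  assumes "\<mu> \<in> multipliers m"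
  shows "dual_objective f fs m \<mu> \<le> inf_primal f fs"
  unfolding inf_primal_def
proof (rule Inf_greatest, clarify)
  fix x assume "\<forall>k\<ge>1. fs k x \<le> 0"
  then have "lagrangian f fs {1..m} \<mu> x \<le> f x"
    using assms by (intro lagrangian_le_objective) (auto simp: multipliers_def PiE_iff)
  then show "dual_objective f fs m \<mu> \<le> f x"
    unfolding dual_objective_def by (rule INF_lower2[OF UNIV_I])
qed

text \<open>
  By weak duality, reaching the primal value from below is the same as equality together with
  attainment.
\<close>

lemma dual_value_attained_iff:
  "inf_primal f fs = sup_dual f fs m \<and> dual_attained f fs m
    \<longleftrightarrow> (\<exists>\<mu>\<in>multipliers m. inf_primal f fs \<le> dual_objective f fs m \<mu>)" (is "?L \<longleftrightarrow> ?R")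
proof
  assume ?L
  then obtain \<mu> where "\<mu> \<in> multipliers m" "dual_objective f fs m \<mu> = inf_primal f fs"
    by (auto simp: dual_attained_def)
  then show ?R by (metis order_refl)
next
  assume ?R
  then obtain \<mu> where \<mu>: "\<mu> \<in> multipliers m" "inf_primal f fs \<le> dual_objective f fs m \<mu>" by blast
  have "sup_dual f fs m \<le> inf_primal f fs"
    unfolding sup_dual_def by (rule SUP_least) (rule weak_duality)
  moreover have "dual_objective f fs m \<mu> \<le> sup_dual f fs m"
    unfolding sup_dual_def using \<mu>(1) by (rule SUP_upper)
  ultimately have "dual_objective f fs m \<mu> = sup_dual f fs m" "inf_primal f fs = sup_dual f fs m"
    using \<mu>(2) by auto
  with \<mu>(1) show ?L by (auto simp: dual_attained_def)
qed

lemma zero_mem_characteristic_set_if: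
  assumes \<mu>: "\<mu> \<in> multipliers m" and le: "ereal (- r) \<le> dual_objective f fs m \<mu>"
  shows "(\<lambda>_. 0, r) \<in> characteristic_set f fs"
proof -
  define l where "l k = (if k \<in> {1..m} then \<mu> k else 0)" for k
  have supp: "{k. l k \<noteq> 0} \<subseteq> {1..m}"
    by (auto simp: l_def split: if_splits)
  have "l \<in> finite_support_multipliers"
    using \<mu> finite_subset[OF supp]
    by (auto simp: finite_support_multipliers_def l_def multipliers_def PiE_iff)
  moreover have "lagrangian f fs {k. l k \<noteq> 0} l = lagrangian f fs {1..m} \<mu>"
    unfolding lagrangian_support[OF finite_atLeastAtMost supp]
    by (rule lagrangian_cong) (simp add: l_def)
  moreover have "ereal (- r) \<le> lagrangian f fs {1..m} \<mu> x" for x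
    using le unfolding dual_objective_def le_INF_iff by blast
  ultimately show ?thesis
    by (auto simp: mem_characteristic_set zero_mem_dual_space intro!: bexI[of _ l])
qed

text \<open>
  Once \<open>m\<close> exceeds the support of a multiplier, restricting the multiplier to \<open>{1..m}\<close> leaves its
  Lagrangian unchanged.
\<close>

lemma eventually_multiplier_if_zero_mem_characteristic_set:
  assumes "(\<lambda>_. 0, r) \<in> characteristic_set f fs"
  shows "\<forall>\<^sub>F m in sequentially. \<exists>\<mu>\<in>multipliers m. ereal (- r) \<le> dual_objective f fs m \<mu>"
proof -
  obtain l where l: "l \<in> finite_support_multipliers"
      "\<And>x. ereal (- r) \<le> lagrangian f fs {k. l k \<noteq> 0} l x"
    using assms by (auto simp: mem_characteristic_set)
  obtain M where M: "\<And>k. l k \<noteq> 0 \<Longrightarrow> k \<le> M"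
    using finite_support_multipliersD(1)[OF l(1)] by (auto simp: finite_nat_set_iff_bounded_le)
  show ?thesis
    using eventually_ge_at_top[of M]
  proof eventually_elim
    case (elim m)
    have supp: "{k. l k \<noteq> 0} \<subseteq> {1..m}"
      using M elim finite_support_multipliersD(3)[OF l(1)] by fastforce
    have "lagrangian f fs {k. l k \<noteq> 0} l = lagrangian f fs {1..m} (restrict l {1..m})"
      unfolding lagrangian_support[OF finite_atLeastAtMost supp]
      by (rule lagrangian_cong) simp
    then have "ereal (- r) \<le> dual_objective f fs m (restrict l {1..m})"
      using l(2) by (simp add: dual_objective_def le_INF_iff)
    moreover have "restrict l {1..m} \<in> multipliers m"
      using finite_support_multipliersD(2)[OF l(1)] by (auto simp: multipliers_def)
    ultimately show ?case by blast
  qed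
qed

theorem corollary5p4:
  fixes f :: "'a::locally_convex_space \<Rightarrow> ereal" and fs :: "nat \<Rightarrow> 'a \<Rightarrow> ereal"
  assumes "f \<in> lsc_proper_convex"
    and "\<And>k. k \<ge> 1 \<Longrightarrow> fs k \<in> lsc_proper_convex"
    and "inf_primal f fs \<noteq> \<infinity>"
  shows "(\<forall>\<^sub>F m in sequentially. inf_primal f fs = sup_dual f fs m \<and> dual_attained f fs m)
    \<longleftrightarrow> wstar_closed_regarding (characteristic_set f fs) ({\<lambda>_. 0} \<times> (UNIV :: real set))"
proof -
  let ?A = "characteristic_set f fs" and ?P = "inf_primal f fs"
  have "?A \<subseteq> topspace dual_times_real"
    by (auto simp: mem_characteristic_set dual_times_real_def weak_star_def)
  then have "?A \<subseteq> dual_times_real closure_of ?A"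
    by (rule closure_of_subset)
  then have closed_iff: "wstar_closed_regarding ?A ({\<lambda>_. 0} \<times> UNIV)
      \<longleftrightarrow> (\<forall>r. ereal (- r) \<le> ?P \<longrightarrow> (\<lambda>_. 0, r) \<in> ?A)"
    using zero_mem_closure_characteristic_set[of f fs, OF assms]
    unfolding wstar_closed_regarding_def by blast
  show ?thesis
    unfolding closed_iff dual_value_attained_iff
  proof (intro iffI allI impI)
    fix r
    assume "\<forall>\<^sub>F m in sequentially. \<exists>\<mu>\<in>multipliers m. ?P \<le> dual_objective f fs m \<mu>"
      and r: "ereal (- r) \<le> ?P"
    then obtain m \<mu> where "\<mu> \<in> multipliers m" "?P \<le> dual_objective f fs m \<mu>"
      by (auto dest: eventually_happens)
    with r show "(\<lambda>_. 0, r) \<in> ?A"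
      by (blast intro: zero_mem_characteristic_set_if order_trans)
  next
    assume closed: "\<forall>r. ereal (- r) \<le> ?P \<longrightarrow> (\<lambda>_. 0, r) \<in> ?A"
    show "\<forall>\<^sub>F m in sequentially. \<exists>\<mu>\<in>multipliers m. ?P \<le> dual_objective f fs m \<mu>"
    proof (cases ?P)
      case (real p)
      then show ?thesis
        using eventually_multiplier_if_zero_mem_characteristic_set[of "- p" f fs] closed by simp
    next
      case MInf
      have "\<exists>\<mu>. \<mu> \<in> multipliers m" for m
        by (intro exI[of _ "\<lambda>k\<in>{1..m}. 0"]) (simp add: multipliers_def)
      with MInf show ?thesis by simp
    qed (use assms(3) in simp)
  qed
qed

end
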